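(* Let $X_1,\ldots,X_n$ be independent centered random vectors in $\mathbb{R}^d$ with densities and with identity covariance matrix, and suppose that each $X_i$ has a Stein matrix $\tau_i(X_i)$ and a score $\rho_i(X_i)$. Let $W_n=\frac{1}{\sqrt{n}}\sum_{i=1}^n X_i$ and $W_n^{(t)}=\sqrt{t}\,W_n+\sqrt{1-t}\,Z$, where $Z$ is a standard Gaussian random vector in $\mathbb{R}^d$ independent of $(X_1,\ldots,X_n)$. Then for all $0\le t<1$, $$J_{st}(W_n^{(t)})\le\frac{t^2}{n^2(1-t)}\sum_{i=1}^n\mathrm{tr}\left(E\left[(Id-\tau_i(X_i))(Id-\tau_i(X_i))^T\right]\right).$$
   Context: Vectors in $\mathbb{R}^d$ are $d\times 1$ columns, $Id$ is the $d\times d$ identity matrix, $\cdot^T$ is the transpose, $\mathrm{tr}$ the trace. The score of a random vector $X$ is the random vector $\rho_X(X)$ (a measurable function of $X$) satisfying $E[\rho_X(X)\varphi(X)]=-E[\nabla\varphi(X)]$ for all real-valued $\varphi\in C_c^\infty(\mathbb{R}^d)$. A Stein matrix of $X$ is any random $d\times d$ matrix $\tau_X(X)$ (a measurable function of $X$) satisfying $E[\tau_X(X)\nabla\varphi(X)]=E[X\varphi(X)]$ for all real-valued $\varphi\in C_c^\infty(\mathbb{R}^d)$. Here $\rho_i=\rho_{X_i}$, $\tau_i=\tau_{X_i}$. For a random vector $V$ with invertible covariance $B$ and score $\rho_V(V)$: $\mathcal{J}(V)=E[(\rho_V(V)+B^{-1}V)(\rho_V(V)+B^{-1}V)^T]$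 and the standardised Fisher information distance is $J_{st}(V)=\mathrm{tr}(B\,\mathcal{J}(V))$. *)

theory Defs
  imports "HOL-Probability.Probability"
begin

text \<open>Smoothness of a function on \<open>\<real>\<^sup>d\<close> is expressed through iterated partial derivatives.\<close>

definition partial_deriv :: "'d \<Rightarrow> (real^'d \<Rightarrow> real) \<Rightarrow> real^'d \<Rightarrow> real" where
  "partial_deriv i f x = frechet_derivative f (at x) (axis i 1)"

primrec C_k :: "nat \<Rightarrow> (real^'d \<Rightarrow> real) \<Rightarrow> bool" where
  "C_k 0 f \<longleftrightarrow> continuous_on UNIV f"
| "C_k (Suc k) f \<longleftrightarrow> (\<forall>x. f differentiable (at x)) \<and> (\<forall>i. C_k k (partial_deriv i f))"

definition test_function :: "(real^'d \<Rightarrow> real) \<Rightarrow> bool" where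
  "test_function \<phi> \<longleftrightarrow> (\<forall>k. C_k k \<phi>) \<and> compact (closure {x. \<phi> x \<noteq> 0})"

definition gradient :: "(real^'d \<Rightarrow> real) \<Rightarrow> real^'d \<Rightarrow> real^'d" where
  "gradient f x = (\<chi> i. partial_deriv i f x)"

text \<open>
  The Bochner integral of a non-integrable function is \<open>0\<close>, so the expectations in the
  defining identities of scores and Stein matrices are explicitly required to exist.
  Each score and each Stein matrix is represented by the function on \<open>\<real>\<^sup>d\<close> that is composed
  with the random vector.
\<close>

definition is_score :: "'a measure \<Rightarrow> ('a \<Rightarrow> real^'d) \<Rightarrow> (real^'d \<Rightarrow> real^'d) \<Rightarrow> bool" where
  "is_score M V \<rho> \<longleftrightarrow> \<rho> \<in> borel_measurable borel \<and>
     (\<forall>\<phi>. test_function \<phi> \<longrightarrow>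
        integrable M (\<lambda>\<omega>. \<phi> (V \<omega>) *\<^sub>R \<rho> (V \<omega>)) \<and>
        integrable M (\<lambda>\<omega>. gradient \<phi> (V \<omega>)) \<and>
        (LINT \<omega>|M. \<phi> (V \<omega>) *\<^sub>R \<rho> (V \<omega>)) = - (LINT \<omega>|M. gradient \<phi> (V \<omega>)))"

definition is_stein_matrix :: "'a measure \<Rightarrow> ('a \<Rightarrow> real^'d) \<Rightarrow> (real^'d \<Rightarrow> real^'d^'d) \<Rightarrow> bool" where
  "is_stein_matrix M V \<tau> \<longleftrightarrow> \<tau> \<in> borel_measurable borel \<and>
     (\<forall>\<phi>. test_function \<phi> \<longrightarrow>
        integrable M (\<lambda>\<omega>. \<tau> (V \<omega>) *v gradient \<phi> (V \<omega>)) \<and>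
        integrable M (\<lambda>\<omega>. \<phi> (V \<omega>) *\<^sub>R V \<omega>) \<and>
        (LINT \<omega>|M. \<tau> (V \<omega>) *v gradient \<phi> (V \<omega>)) = (LINT \<omega>|M. \<phi> (V \<omega>) *\<^sub>R V \<omega>))"

text \<open>\<open>v v\<^sup>T\<close>; the annotations fix the inner dimension, which the library functions leave open.\<close>

definition outer_product :: "real^'d \<Rightarrow> real^'d^'d" where
  "outer_product v = (columnvector v :: real^1^'d) ** (rowvector v :: real^'d^1)"

definition covariance_matrix :: "'a measure \<Rightarrow> ('a \<Rightarrow> real^'d) \<Rightarrow> real^'d^'d" where
  "covariance_matrix M V = (LINT \<omega>|M. outer_product (V \<omega> - (LINT \<omega>'|M. V \<omega>')))"

text \<open>The score \<open>\<rho>\<close> of \<open>V\<close>, which is only determined almost surely, is passed as an argument.\<close>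

definition fisher_integrand ::
  "'a measure \<Rightarrow> ('a \<Rightarrow> real^'d) \<Rightarrow> (real^'d \<Rightarrow> real^'d) \<Rightarrow> 'a \<Rightarrow> real^'d^'d" where
  "fisher_integrand M V \<rho> \<omega> = outer_product (\<rho> (V \<omega>) + matrix_inv (covariance_matrix M V) *v V \<omega>)"

definition J_matrix :: "'a measure \<Rightarrow> ('a \<Rightarrow> real^'d) \<Rightarrow> (real^'d \<Rightarrow> real^'d) \<Rightarrow> real^'d^'d" where
  "J_matrix M V \<rho> = (LINT \<omega>|M. fisher_integrand M V \<rho> \<omega>)"

definition J_st :: "'a measure \<Rightarrow> ('a \<Rightarrow> real^'d) \<Rightarrow> (real^'d \<Rightarrow> real^'d) \<Rightarrow> real" where
  "J_st M V \<rho> = trace (covariance_matrix M V ** J_matrix M V \<rho>)"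

text \<open>
  The trace of \<open>E[A A\<^sup>T]\<close>. The diagonal entries of \<open>A A\<^sup>T\<close> are nonnegative, so their
  expectations are taken in \<open>[0, \<infinity>]\<close>, and no square integrability of \<open>A\<close> has to be assumed.
\<close>

definition trace_expectation_sq :: "'a measure \<Rightarrow> ('a \<Rightarrow> real^'d^'d) \<Rightarrow> ennreal" where
  "trace_expectation_sq M A =
     (\<Sum>j\<in>UNIV. \<integral>\<^sup>+\<omega>. ennreal ((A \<omega> ** transpose (A \<omega>)) $ j $ j) \<partial>M)"

text \<open>Unlike \<open>indep_var\<close>, this allows the two random variables to have values in different types.\<close>

definition indep_pair ::
  "'a measure \<Rightarrow> 'b measure \<Rightarrow> ('a \<Rightarrow> 'b) \<Rightarrow> 'c measure \<Rightarrow> ('a \<Rightarrow> 'c) \<Rightarrow> bool" where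
  "indep_pair M S U T V \<longleftrightarrow> U \<in> measurable M S \<and> V \<in> measurable M T \<and>
     prob_space.indep_set M {U -` A \<inter> space M | A. A \<in> sets S} {V -` B \<inter> space M | B. B \<in> sets T}"

definition std_gaussian_density :: "real^'d \<Rightarrow> real" where
  "std_gaussian_density x = (\<Prod>j\<in>UNIV. std_normal_density (x $ j))"

definition normalized_sum :: "nat \<Rightarrow> (nat \<Rightarrow> 'a \<Rightarrow> real^'d) \<Rightarrow> 'a \<Rightarrow> real^'d" where
  "normalized_sum n X \<omega> = (1 / sqrt (real n)) *\<^sub>R (\<Sum>i=1..n. X i \<omega>)"

definition gaussian_interpolation ::
  "real \<Rightarrow> ('a \<Rightarrow> real^'d) \<Rightarrow> ('a \<Rightarrow> real^'d) \<Rightarrow> 'a \<Rightarrow> real^'d" where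
  "gaussian_interpolation t V Z \<omega> = sqrt t *\<^sub>R V \<omega> + sqrt (1 - t) *\<^sub>R Z \<omega>"

end

theory Submission
  imports Defs
begin

text \<open>
  Write \<open>V = a \<Sum> X\<^sub>i + s Z\<close> with \<open>a = sqrt (t / n)\<close> and \<open>s = sqrt (1 - t)\<close>; it has identity covariance.
  Gaussian integration by parts in \<open>Z\<close> and the Stein identity in each \<open>X\<^sub>i\<close>, the other summands
  being frozen by independence, show that \<open>\<rho>(V) + V\<close> is the conditional expectation given \<open>V\<close> of
  \<open>- t / (n s) \<Sum> (Id - \<tau>\<^sub>i(X\<^sub>i)) Z\<close>. Conditional expectation contracts \<open>L\<^sup>2\<close>, and
  the second moment of this vector splits, since \<open>Z\<close> has identity covariance and the matrices
  \<open>Id - \<tau>\<^sub>i(X\<^sub>i)\<close> are independent and centred. A function of \<open>V\<close> is identified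
  with a conditional expectation by testing only against smooth compactly supported functions,
  which suffices because indicators of boxes are limits of such functions.
\<close>

subsection \<open>Iterated partial derivatives and test functions\<close>

text \<open>The Stein identity is available only for compactly supported functions, whereas the
  centring of \<open>Id - \<tau>\<^sub>i(X\<^sub>i)\<close> amounts to testing it against
  coordinates: \<open>E[\<tau>\<^sub>i(X\<^sub>i)] = E[X\<^sub>i X\<^sub>i^T] = Id\<close>.
  Truncated coordinates with uniformly bounded gradients bridge this gap. The factor
  \<open>- t / (n s)\<close> balances two identities. With \<open>D = E[grad \<phi>(V)]\<close>, one
  has \<open>E[\<phi>(V) (\<rho>(V) + V)] = a \<Sum> E[\<phi>(V) X\<^sub>i] - t D\<close> and
  \<open>E[\<phi>(V) (Id - \<tau>\<^sub>i(X\<^sub>i)) Z] = s (D - E[\<phi>(V) X\<^sub>i] /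
  a)\<close>; summing the second over \<open>i\<close> and scaling gives the first because
  \<open>a^2 = t / n\<close>. Two degenerate situations need their own arguments. For
  \<open>t = 0\<close> one cannot divide by \<open>a\<close>, and
  \<open>x \<mapsto> \<phi> (a x + u)\<close> is constant instead of compactly supported. And the
  right-hand side may be infinite, yet the Fisher integrand must still be integrable, since
  otherwise its Bochner integral would be 0 and the bound void. For this
  \<open>\<rho>(V) + V\<close> is also represented as the conditional expectation of
  \<open>V - Z / s\<close>, which has second moments whatever the \<open>\<tau>\<^sub>i\<close>
  are.\<close>

lemma partial_deriv_eq:
  assumes "(f has_derivative D) (at x)"
  shows "partial_deriv i f x = D (axis i 1)"
  using frechet_derivative_at[OF assms] by (simp add: partial_deriv_def)

text \<open>\<open>C_k\<close> demands continuity only at the highest order; below it, continuity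
  follows from differentiability, which is the base case.\<close>

lemma C_k_Suc_imp_C_k: "C_k (Suc k) f \<Longrightarrow> C_k k f"
proof (induction k arbitrary: f)
  case 0
  then have "\<And>x. f differentiable (at x)" by simp
  then show ?case
    by (simp add: continuous_on_eq_continuous_within differentiable_imp_continuous_within)
next
  case (Suc k)
  from Suc.prems show ?case by (auto simp del: C_k.simps(1) intro: Suc.IH)
qed

lemma C_k_imp_continuous: "C_k k f \<Longrightarrow> continuous_on UNIV f"
  by (induction k) (simp_all add: C_k_Suc_imp_C_k del: C_k.simps(2))

lemma C_k_imp_has_derivative:
  assumes "C_k (Suc k) f"
  shows "(f has_derivative frechet_derivative f (at x)) (at x)"
  using assms by (simp add: frechet_derivative_works)

lemma C_k_const: "C_k k (\<lambda>x::real^'d. c)"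
proof (induction k arbitrary: c)
  case (Suc k)
  have "partial_deriv i (\<lambda>x::real^'d. c) = (\<lambda>x. 0)" for i
    by (rule ext, rule partial_deriv_eq) (rule has_derivative_const)
  then show ?case using Suc by simp
qed simp

lemma C_k_add:
  assumes "C_k k f" "C_k k g"
  shows "C_k k (\<lambda>x. f x + g x)"
  using assms
proof (induction k arbitrary: f g)
  case (Suc k)
  have "partial_deriv i (\<lambda>x. f x + g x) = (\<lambda>x. partial_deriv i f x + partial_deriv i g x)" for i
    unfolding partial_deriv_def[of i f] partial_deriv_def[of i g]
    by (rule ext, rule partial_deriv_eq, rule has_derivative_add)
       (rule C_k_imp_has_derivative, rule Suc.prems)+
  then show ?case using Suc by auto
qed (auto intro: continuous_intros)

lemma partial_deriv_mult:
  assumes "f differentiable (at x)" "g differentiable (at x)"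
  shows "partial_deriv i (\<lambda>x. f x * g x) x = f x * partial_deriv i g x + partial_deriv i f x * g x"
  unfolding partial_deriv_def[of i f] partial_deriv_def[of i g]
  by (rule partial_deriv_eq) (use assms in \<open>auto simp: frechet_derivative_works intro!: has_derivative_mult\<close>)

lemma C_k_mult:
  assumes "C_k k f" "C_k k g"
  shows "C_k k (\<lambda>x. f x * g x)"
  using assms
proof (induction k arbitrary: f g)
  case (Suc k)
  have "partial_deriv i (\<lambda>x. f x * g x) = (\<lambda>x. f x * partial_deriv i g x + partial_deriv i f x * g x)" for i
    using Suc.prems by (auto simp: partial_deriv_mult)
  moreover have "C_k k (\<lambda>x. f x * partial_deriv i g x + partial_deriv i f x * g x)" for i
    using Suc.prems by (intro C_k_add Suc.IH) (simp_all add: C_k_Suc_imp_C_k del: C_k.simps(2), simp_all)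
  ultimately show ?case using Suc.prems by (simp add: differentiable_mult)
qed (auto intro: continuous_intros)

lemma C_k_prod:
  assumes "finite I" "\<And>i. i \<in> I \<Longrightarrow> C_k k (f i)"
  shows "C_k k (\<lambda>x. \<Prod>i\<in>I. f i x)"
  using assms by (induction I rule: finite_induct) (auto intro: C_k_mult C_k_const)

lemma has_derivative_affine:
  fixes f :: "real^'d \<Rightarrow> real"
  assumes "f differentiable (at (c *\<^sub>R x + b))"
  shows "((\<lambda>x. f (c *\<^sub>R x + b)) has_derivative
    (\<lambda>h. frechet_derivative f (at (c *\<^sub>R x + b)) (c *\<^sub>R h))) (at x)"
  by (rule has_derivative_compose[where f="\<lambda>x. c *\<^sub>R x + b"])
    (use assms in \<open>auto intro!: derivative_eq_intros simp: frechet_derivative_works\<close>)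

lemma partial_deriv_affine:
  fixes f :: "real^'d \<Rightarrow> real"
  assumes "f differentiable (at (c *\<^sub>R x + b))"
  shows "partial_deriv i (\<lambda>x. f (c *\<^sub>R x + b)) x = c * partial_deriv i f (c *\<^sub>R x + b)"
  using partial_deriv_eq[OF has_derivative_affine[OF assms]]
    linear_cmul[OF linear_frechet_derivative[OF assms], of c "axis i 1"]
  by (simp add: partial_deriv_def)

lemma C_k_affine:
  fixes f :: "real^'d \<Rightarrow> real"
  assumes "C_k k f"
  shows "C_k k (\<lambda>x. f (c *\<^sub>R x + b))"
  using assms
proof (induction k arbitrary: f)
  case 0
  then show ?case
    by (auto intro!: continuous_intros continuous_on_compose2[where s="UNIV" and t=UNIV and g=f])
next
  case (Suc k)
  have d: "(\<lambda>x. f (c *\<^sub>R x + b)) differentiable (at x)" for x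
    using Suc.prems has_derivative_affine differentiableI by fastforce
  have "partial_deriv i (\<lambda>x. f (c *\<^sub>R x + b)) = (\<lambda>x. c * partial_deriv i f (c *\<^sub>R x + b))" for i
    using Suc.prems by (auto simp: partial_deriv_affine)
  then show ?case using Suc d by (auto intro!: C_k_mult C_k_const)
qed

lemma partial_deriv_coord:
  fixes x :: "real^'d"
  assumes "(F has_real_derivative F') (at (x $ i))"
  shows "partial_deriv j (\<lambda>x. F (x $ i)) x = (if j = i then F' else 0)"
proof -
  have "((\<lambda>x. F (x $ i)) has_derivative (\<lambda>h. F' * (h $ i))) (at x)"
    by (rule has_derivative_compose[where f="\<lambda>x. x $ i" and g=F, OF _ assms[unfolded has_field_derivative_def]])
      (auto intro!: bounded_linear_imp_has_derivative)
  from partial_deriv_eq[OF this] show ?thesis by (auto simp: axis_def)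
qed

section \<open>Smooth functions of one real variable\<close>

text \<open>The whole sequence of derivatives is the witness, so a concrete function is smooth as
  soon as a closed form for all its derivatives is exhibited.\<close>

definition smooth_real :: "(real \<Rightarrow> real) \<Rightarrow> bool" where
  "smooth_real F \<longleftrightarrow> (\<exists>D. D 0 = F \<and> (\<forall>k x. (D k has_real_derivative D (Suc k) x) (at x)))"

text \<open>The partial derivative in direction \<open>i\<close> moves from \<open>D m\<close> to
  \<open>D (Suc m)\<close>, so the induction on \<open>k\<close> closes only with \<open>m\<close>
  arbitrary; in every other direction it is 0.\<close>

lemma C_k_coord_iterate:
  assumes "\<And>k x. (D k has_real_derivative D (Suc k) x) (at x)"
  shows "C_k k (\<lambda>x::real^'d. D m (x $ i))"
proof (induction k arbitrary: m)
  case 0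
  have "continuous_on UNIV (D m)"
    using assms by (meson DERIV_continuous_on has_field_derivative_at_within)
  then show ?case
    by (auto intro!: continuous_intros continuous_on_compose2[where s="UNIV" and t=UNIV and g="D m"])
next
  case (Suc k)
  have "partial_deriv j (\<lambda>x. D m (x $ i)) = (if j = i then (\<lambda>x::real^'d. D (Suc m) (x $ i)) else (\<lambda>x. 0))" for j
    by (auto simp: partial_deriv_coord[OF assms])
  moreover have "(\<lambda>x. D m (x $ i)) differentiable (at x)" for x :: "real^'d"
    by (rule differentiable_compose[where g="\<lambda>x. x $ i" and f="D m"])
      (auto simp: real_differentiable_def intro!: derivative_intros bounded_linear_imp_differentiable exI assms bounded_linear_vec_nth
        intro: has_field_derivative_at_within)
  ultimately show ?case using Suc by (auto intro: C_k_const)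
qed

lemma C_k_coord: "smooth_real F \<Longrightarrow> C_k k (\<lambda>x::real^'d. F (x $ i))"
  unfolding smooth_real_def using C_k_coord_iterate by blast

lemma smooth_real_id: "smooth_real (\<lambda>x. x)"
  unfolding smooth_real_def
  by (rule exI[of _ "\<lambda>k x. if k = 0 then x else if k = 1 then 1 else 0"])
     (auto intro!: derivative_eq_intros)

text \<open>The classical smooth function that is flat at 0 and not analytic there.\<close>

definition flat_exp :: "real \<Rightarrow> real" where
  "flat_exp x = (if x > 0 then exp (- inverse x) else 0)"

text \<open>The functions \<open>p(1/x) exp(-1/x)\<close> are closed under differentiation: with
  \<open>y = 1/x\<close>, the chain rule gives the polynomial \<open>y^2 (p - p')\<close>. At 0 the
  derivative vanishes because the exponential beats every polynomial in \<open>1/x\<close>.\<close>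

lemma flat_exp_iterate:
  fixes p :: "real poly"
  shows "((\<lambda>x. poly p (inverse x) * flat_exp x) has_real_derivative
     poly ([:0,0,1:] * (p - pderiv p)) (inverse x) * flat_exp x) (at x)" (is "(?f has_real_derivative ?d) _")
proof -
  consider "x > 0" | "x < 0" | "x = 0" by linarith
  then show ?thesis
  proof cases
    case 1
    have "((\<lambda>x. poly p (inverse x) * exp (- inverse x)) has_real_derivative ?d) (at x)"
      using 1 by (auto intro!: derivative_eq_intros DERIV_chain2[OF poly_DERIV] simp: flat_exp_def algebra_simps power2_eq_square)
    moreover have "\<forall>\<^sub>F y in nhds x. poly p (inverse y) * exp (- inverse y) = ?f y"
      using 1 by (intro eventually_mono[OF eventually_nhds_in_open[of "{0<..}" x]]) (auto simp: flat_exp_def)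
    ultimately show ?thesis by (subst (asm) DERIV_cong_ev[OF refl _ refl])
  next
    case 2
    have "((\<lambda>x. 0) has_real_derivative ?d) (at x)"
      using 2 by (auto simp: flat_exp_def)
    moreover have "\<forall>\<^sub>F y in nhds x. 0 = ?f y"
      using 2 by (intro eventually_mono[OF eventually_nhds_in_open[of "{..<0}" x]]) (auto simp: flat_exp_def)
    ultimately show ?thesis by (subst (asm) DERIV_cong_ev[OF refl _ refl])
  next
    case 3
    have right: "((\<lambda>h. ?f h / h) \<longlongrightarrow> 0) (at_right 0)"
    proof -
      have "((\<lambda>y. \<Sum>i\<le>degree q. coeff q i * (y ^ i / exp y)) \<longlongrightarrow> (\<Sum>i\<le>degree q. coeff q i * 0)) at_top" for q :: "real poly"
        by (intro tendsto_intros tendsto_power_div_exp_0)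
      \<comment> \<open>\<open>pCons 0 p\<close> is \<open>y * p(y)\<close>: the extra factor
        absorbs the \<open>1/h\<close> of the difference quotient after the substitution
        \<open>y = 1/h\<close>.\<close>
      then have "((\<lambda>y. poly (pCons 0 p) y / exp y) \<longlongrightarrow> 0) at_top"
        unfolding poly_altdef sum_divide_distrib
        by (simp only: times_divide_eq_right mult_zero_right sum.neutral_const)
      then have "((\<lambda>y. poly (pCons 0 p) (inverse y) / exp (inverse y)) \<longlongrightarrow> 0) (at_right 0)"
        by (rule filterlim_compose[OF _ filterlim_inverse_at_top_right])
      moreover have "\<forall>\<^sub>F y in at_right 0. poly (pCons 0 p) (inverse y) / exp (inverse y) = ?f y / y"
        by (rule eventually_at_rightI[of 0 1]) (auto simp: flat_exp_def exp_minus field_simps)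
      ultimately show ?thesis by (rule Lim_transform_eventually)
    qed
    have left: "((\<lambda>h. ?f h / h) \<longlongrightarrow> 0) (at_left 0)"
      by (rule Lim_transform_eventually[OF tendsto_const], rule eventually_at_leftI[of "-1"])
         (auto simp: flat_exp_def)
    have "((\<lambda>h. ?f h / h) \<longlongrightarrow> 0) (at 0)"
      using left right by (simp add: filterlim_split_at)
    then show ?thesis unfolding 3 DERIV_def add_0_left by (simp add: flat_exp_def)
  qed
qed

lemma smooth_flat_exp: "smooth_real flat_exp"
proof -
  define P where "P k = ((\<lambda>p::real poly. [:0,0,1:] * (p - pderiv p)) ^^ k) 1" for k
  have "((\<lambda>x. poly (P k) (inverse x) * flat_exp x) has_real_derivative
      poly (P (Suc k)) (inverse x) * flat_exp x) (at x)" for k x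
    using flat_exp_iterate[of "P k" x] by (simp add: P_def)
  then show ?thesis unfolding smooth_real_def
    by (intro exI[of _ "\<lambda>k x. poly (P k) (inverse x) * flat_exp x"]) (auto simp: P_def)
qed

lemma smooth_real_affine:
  assumes "smooth_real F"
  shows "smooth_real (\<lambda>x. F (a * x + b))"
proof -
  from assms obtain D where D: "D 0 = F" "\<And>k x. (D k has_real_derivative D (Suc k) x) (at x)"
    unfolding smooth_real_def by blast
  have "((\<lambda>x. a ^ k * D k (a * x + b)) has_real_derivative a ^ Suc k * D (Suc k) (a * x + b)) (at x)" for k x
    by (auto intro!: derivative_eq_intros DERIV_chain2[OF D(2)])
  then show ?thesis unfolding smooth_real_def
    by (intro exI[of _ "\<lambda>k x. a ^ k * D k (a * x + b)"]) (auto simp: D)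
qed

text \<open>Differentiating \<open>p(x) exp(-x^2/2)\<close> replaces \<open>p\<close> by
  \<open>p' - x p\<close>; started at 1 this yields the Hermite polynomials up to sign.\<close>

lemma smooth_exp_neg_square: "smooth_real (\<lambda>x. exp (- x\<^sup>2 / 2))"
proof -
  define P where "P k = ((\<lambda>p::real poly. pderiv p - [:0,1:] * p) ^^ k) 1" for k
  have "((\<lambda>x. poly (P k) x * exp (- x\<^sup>2 / 2)) has_real_derivative
      poly (P (Suc k)) x * exp (- x\<^sup>2 / 2)) (at x)" for k x
    by (auto intro!: derivative_eq_intros poly_DERIV simp: P_def algebra_simps)
  then show ?thesis unfolding smooth_real_def
    by (intro exI[of _ "\<lambda>k x. poly (P k) x * exp (- x\<^sup>2 / 2)"]) (auto simp: P_def)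
qed

section \<open>Closure properties of test functions\<close>

lemma test_function_iff:
  "test_function f \<longleftrightarrow> (\<forall>k. C_k k f) \<and> bounded {x. f x \<noteq> 0}"
  by (simp add: test_function_def compact_closure)

lemma test_function_continuous: "test_function f \<Longrightarrow> continuous_on UNIV f"
  unfolding test_function_iff using C_k_imp_continuous by blast

lemma test_function_measurable: "test_function f \<Longrightarrow> f \<in> borel_measurable borel"
  by (intro borel_measurable_continuous_onI test_function_continuous)

lemma test_function_differentiable: "test_function f \<Longrightarrow> f differentiable (at x)"
  unfolding test_function_iff using C_k.simps(2) by blast

lemma test_function_partial_deriv:
  assumes "test_function f"
  shows "test_function (partial_deriv i f)"
proof -
  have "partial_deriv i f x = 0" if "x \<notin> closure {x. f x \<noteq> 0}" for x
  proof -
    have "(f has_derivative (\<lambda>_. 0)) (at x)"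
      by (rule has_derivative_transform_within_open[OF has_derivative_const, of "- closure {x. f x \<noteq> 0}" x 0])
        (use that closure_subset[of "{x. f x \<noteq> 0}"] in auto)
    from partial_deriv_eq[OF this] show ?thesis by simp
  qed
  then have "{x. partial_deriv i f x \<noteq> 0} \<subseteq> closure {x. f x \<noteq> 0}" by blast
  then have "bounded {x. partial_deriv i f x \<noteq> 0}"
    using assms by (auto simp: test_function_iff intro: bounded_subset bounded_closure)
  moreover have "C_k k (partial_deriv i f)" for k
    using assms C_k.simps(2) unfolding test_function_iff by blast
  ultimately show ?thesis by (simp add: test_function_iff)
qed

lemma test_function_bounded:
  assumes "test_function f"
  obtains B where "B \<ge> 0" "\<And>x. \<bar>f x\<bar> \<le> B"
proof -
  have "compact (f ` closure {x. f x \<noteq> 0})"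
    using assms test_function_continuous[OF assms]
    by (intro compact_continuous_image) (auto simp: test_function_def intro: continuous_on_subset)
  then obtain B where "\<And>x. x \<in> closure {x. f x \<noteq> 0} \<Longrightarrow> \<bar>f x\<bar> \<le> B"
    using compact_imp_bounded bounded_iff by (metis imageI real_norm_def)
  then have "\<bar>f x\<bar> \<le> max B 0" for x
    using closure_subset[of "{x. f x \<noteq> 0}"] by (cases "f x = 0") fastforce+
  then show ?thesis using that by (metis max.cobounded2)
qed

lemma test_function_mult:
  assumes "\<And>k. C_k k f" "test_function g"
  shows "test_function (\<lambda>x. f x * g x)"
  using assms unfolding test_function_iff by (auto intro: C_k_mult bounded_subset)

text \<open>The support is pulled back by an affine bijection and stays bounded. With
  \<open>c = 0\<close> the function would be constant, which is why the case \<open>t = 0\<close> is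
  later treated apart.\<close>

lemma test_function_affine:
  fixes f :: "real^'d \<Rightarrow> real"
  assumes "test_function f" "c \<noteq> 0"
  shows "test_function (\<lambda>x. f (c *\<^sub>R x + b))"
proof -
  have "{x. f (c *\<^sub>R x + b) \<noteq> 0} \<subseteq> (\<lambda>y. (1 / c) *\<^sub>R y + (- (1 / c) *\<^sub>R b)) ` {x. f x \<noteq> 0}"
  proof
    fix x assume "x \<in> {x. f (c *\<^sub>R x + b) \<noteq> 0}"
    then show "x \<in> (\<lambda>y. (1 / c) *\<^sub>R y + (- (1 / c) *\<^sub>R b)) ` {x. f x \<noteq> 0}"
      by (intro image_eqI[of _ _ "c *\<^sub>R x + b"]) (use assms(2) in \<open>auto simp: scaleR_add_right\<close>)
  qed
  moreover have "bounded ((\<lambda>y. (1 / c) *\<^sub>R y + (- (1 / c) *\<^sub>R b)) ` {x. f x \<noteq> 0})"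
  proof -
    have "bounded ((\<lambda>y. (- (1 / c) *\<^sub>R b) + y) ` (\<lambda>y. (1 / c) *\<^sub>R y) ` {x. f x \<noteq> 0})"
      using assms by (intro bounded_translation bounded_scaling) (auto simp: test_function_iff)
    then show ?thesis by (simp add: image_image add.commute)
  qed
  ultimately show ?thesis
    using assms by (auto simp: test_function_iff intro: C_k_affine bounded_subset)
qed

section \<open>Bump functions approximating indicators of boxes\<close>

lemma flat_exp_bounds: "0 \<le> flat_exp x" "flat_exp x \<le> 1"
  by (auto simp: flat_exp_def)

lemma flat_exp_tendsto: "(\<lambda>m. flat_exp (real (Suc m) * y)) \<longlonglongrightarrow> (if y > 0 then 1 else 0)"
proof (cases "y > 0")
  case True
  have "(\<lambda>m. exp (- (inverse (real (Suc m)) * inverse y))) \<longlonglongrightarrow> exp (- (0 * inverse y))"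
    by (intro tendsto_intros LIMSEQ_inverse_real_of_nat)
  then show ?thesis using True by (simp add: flat_exp_def)
next
  case False
  then have "flat_exp (real (Suc m) * y) = 0" for m
    by (simp add: flat_exp_def mult_le_0_iff not_less)
  then show ?thesis using False by simp
qed

text \<open>Each face of the box contributes one factor, which vanishes beyond that face and
  increases to 1 on its inner side as \<open>m\<close> grows. \<open>Suc m\<close> avoids the
  dilation by 0, which would kill every factor.\<close>

definition box_bump :: "real^'d \<Rightarrow> real^'d \<Rightarrow> nat \<Rightarrow> real^'d \<Rightarrow> real" where
  "box_bump a b m x = (\<Prod>i\<in>UNIV. flat_exp (real (Suc m) * (x $ i - a $ i)) * flat_exp (real (Suc m) * (b $ i - x $ i)))"

lemma box_bump_bounds: "0 \<le> box_bump a b m x" "box_bump a b m x \<le> 1"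
  unfolding box_bump_def by (auto intro!: prod_nonneg prod_le_1 mult_nonneg_nonneg mult_le_one simp: flat_exp_bounds)

lemma box_bump_support: "x \<notin> box a b \<Longrightarrow> box_bump a b m x = 0"
  by (auto simp: box_bump_def mem_box_cart flat_exp_def zero_less_mult_iff)

lemma test_function_box_bump: "test_function (box_bump a b m)"
proof -
  have "smooth_real (\<lambda>y. flat_exp (real (Suc m) * y + c))" "smooth_real (\<lambda>y. flat_exp (- real (Suc m) * y + c))" for c
    by (rule smooth_real_affine[OF smooth_flat_exp])+
  note s = this(1)[of "- real (Suc m) * a $ i" for i] this(2)[of "real (Suc m) * b $ i" for i]
  have "C_k k (\<lambda>x. \<Prod>i\<in>UNIV. flat_exp (real (Suc m) * (x $ i) + - real (Suc m) * a $ i)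
       * flat_exp (- real (Suc m) * (x $ i) + real (Suc m) * b $ i))" for k
    by (intro C_k_prod C_k_mult s[THEN C_k_coord]) auto
  then have "C_k k (box_bump a b m)" for k
    unfolding box_bump_def[abs_def] by (simp add: algebra_simps)
  moreover have "bounded {x. box_bump a b m x \<noteq> 0}"
    by (rule bounded_subset[OF bounded_box[of a b]]) (use box_bump_support in blast)
  ultimately show ?thesis by (simp add: test_function_iff)
qed

lemma box_bump_tendsto: "(\<lambda>m. box_bump a b m x) \<longlonglongrightarrow> indicator (box a b) x"
proof -
  have "(\<lambda>m. box_bump a b m x) \<longlonglongrightarrow>
      (\<Prod>i\<in>UNIV. (if x $ i - a $ i > 0 then 1 else 0) * (if b $ i - x $ i > 0 then 1 else 0))"
    unfolding box_bump_def by (intro tendsto_intros flat_exp_tendsto)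
  also have "(\<Prod>i\<in>UNIV. (if x $ i - a $ i > 0 then 1 else 0) * (if b $ i - x $ i > 0 then 1 else 0))
      = (indicator (box a b) x :: real)"
    by (auto simp: indicator_def mem_box_cart)
  finally show ?thesis .
qed

lemma box_bump_positive: "x \<in> box a b \<Longrightarrow> box_bump a b m x > 0"
  unfolding box_bump_def by (rule prod_pos) (auto simp: mem_box_cart flat_exp_def)

text \<open>Serves as a majorant: it dominates all \<open>box_bump a b m\<close> at once. A bump
  that is positive on the compact box is divided by its minimum there.\<close>

lemma test_function_ge_1_on_cbox:
  obtains \<psi> :: "real^'d \<Rightarrow> real" where "test_function \<psi>" "\<And>x. x \<in> cbox a b \<Longrightarrow> 1 \<le> \<psi> x"
proof -
  \<comment> \<open>Enlarging the open box by 1 in every coordinate puts the closed box inside the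
    region where the bump is positive.\<close>
  define \<beta> where "\<beta> = box_bump (a - 1) (b + 1) 0"
  have pos: "\<beta> x > 0" if "x \<in> cbox a b" for x
    unfolding \<beta>_def using that
    by (intro box_bump_positive) (simp add: mem_box_cart, smt (verit))
  have t: "test_function \<beta>" by (simp add: \<beta>_def test_function_box_bump)
  obtain c where c: "c > 0" "\<And>x. x \<in> cbox a b \<Longrightarrow> c \<le> \<beta> x"
  proof (cases "cbox a b = {}")
    case True
    then show ?thesis using that[of 1] by simp
  next
    case False
    then obtain x0 where "x0 \<in> cbox a b" "\<And>x. x \<in> cbox a b \<Longrightarrow> \<beta> x0 \<le> \<beta> x"
      using continuous_attains_inf[of "cbox a b" \<beta>] test_function_continuous[OF t]
      by (meson compact_cbox continuous_on_subset subset_UNIV)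
    then show ?thesis using that[of "\<beta> x0"] pos by blast
  qed
  have "test_function (\<lambda>x. (1 / c) * \<beta> x)"
    by (intro test_function_mult C_k_const t)
  then show ?thesis using c by (intro that[of "\<lambda>x. (1 / c) * \<beta> x"]) auto
qed

section \<open>Lebesgue and Gaussian integrals of test functions\<close>

lemma test_function_support:
  assumes "test_function (f :: real^'d \<Rightarrow> real)"
  obtains R where "R > 0" "\<And>x. f x \<noteq> 0 \<Longrightarrow> norm x \<le> R"
  using assms unfolding test_function_iff bounded_pos by auto

lemma test_function_integrable_lborel:
  assumes "test_function (f :: real^'d \<Rightarrow> real)"
  shows "integrable lborel f"
proof -
  obtain B where B: "B \<ge> 0" "\<And>x. \<bar>f x\<bar> \<le> B" by (rule test_function_bounded[OF assms]) blast
  obtain R where R: "R > 0" "\<And>x. f x \<noteq> 0 \<Longrightarrow> norm x \<le> R" by (rule test_function_support[OF assms]) blast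
  have "integrable lborel (\<lambda>x::real^'d. B * indicator (cball 0 R) x)"
    by (intro integrable_mult_right integrable_real_indicator) (auto intro!: emeasure_bounded_finite simp flip: infinity_ennreal_def)
  then show ?thesis
    by (rule Bochner_Integration.integrable_bound)
       (use test_function_measurable[OF assms] B R in \<open>auto simp: indicator_def split: if_splits\<close>)
qed

lemma has_real_derivative_along_axis:
  fixes f :: "real^'d \<Rightarrow> real"
  assumes "f differentiable (at (z + s *\<^sub>R axis j 1))"
  shows "((\<lambda>s. f (z + s *\<^sub>R axis j 1)) has_real_derivative partial_deriv j f (z + s *\<^sub>R axis j 1)) (at s)"
proof -
  let ?D = "frechet_derivative f (at (z + s *\<^sub>R axis j 1))"
  have "((\<lambda>s. f (z + s *\<^sub>R axis j 1)) has_derivative (\<lambda>h. ?D (h *\<^sub>R axis j 1))) (at s)"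
    by (rule has_derivative_compose[where f="\<lambda>s. z + s *\<^sub>R axis j 1"])
      (use assms in \<open>auto intro!: derivative_eq_intros simp: frechet_derivative_works\<close>)
  moreover have "(\<lambda>h. ?D (h *\<^sub>R axis j 1)) = (\<lambda>h. partial_deriv j f (z + s *\<^sub>R axis j 1) * h)"
    using linear_cmul[OF linear_frechet_derivative[OF assms]] by (auto simp: partial_deriv_def)
  ultimately show ?thesis by (simp add: has_field_derivative_def)
qed

text \<open>Translation invariance of \<open>lborel\<close> makes the difference quotients integrate to \<open>0\<close>.\<close>

lemma integral_partial_deriv_eq_0:
  assumes f: "test_function (f :: real^'d \<Rightarrow> real)"
  shows "(\<integral>x. partial_deriv j f x \<partial>lborel) = 0"
proof -
  define q where "q m z = (f (z + inverse (real (Suc m)) *\<^sub>R axis j 1) - f z) / inverse (real (Suc m))" for m z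
  note d = test_function_partial_deriv[OF f, of j]
  note [measurable] = test_function_measurable[OF f] test_function_measurable[OF d]
  obtain B where B: "B \<ge> 0" "\<And>x. \<bar>partial_deriv j f x\<bar> \<le> B" by (rule test_function_bounded[OF d]) blast
  obtain R where R: "R > 0" "\<And>x. f x \<noteq> 0 \<Longrightarrow> norm x \<le> R" by (rule test_function_support[OF f]) blast
  have "(\<lambda>m. \<integral>z. q m z \<partial>lborel) \<longlonglongrightarrow> (\<integral>z. partial_deriv j f z \<partial>lborel)"
  \<comment> \<open>By the mean value theorem the difference quotients are bounded by the bound
    \<open>B\<close> of the derivative. They vanish outside radius \<open>R + 1\<close>, since the
    increments have length at most 1.\<close>
  proof (rule integral_dominated_convergence[where w="\<lambda>z. B * indicator (cball 0 (R + 1)) z"])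
    show "integrable lborel (\<lambda>z::real^'d. B * indicator (cball 0 (R + 1)) z)"
      by (intro integrable_mult_right integrable_real_indicator) (auto intro!: emeasure_bounded_finite simp flip: infinity_ennreal_def)
    show "AE z in lborel. (\<lambda>m. q m z) \<longlonglongrightarrow> partial_deriv j f z"
    proof (rule AE_I2)
      fix z :: "real^'d"
      have "((\<lambda>s. f (z + s *\<^sub>R axis j 1)) has_real_derivative partial_deriv j f z) (at 0)"
        using has_real_derivative_along_axis[OF test_function_differentiable[OF f], where z=z and s=0 and j=j] by simp
      then have "((\<lambda>h. (f (z + h *\<^sub>R axis j 1) - f z) / h) \<longlongrightarrow> partial_deriv j f z) (at 0)"
        by (simp add: DERIV_def)
      then show "(\<lambda>m. q m z) \<longlonglongrightarrow> partial_deriv j f z"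
        unfolding q_def tendsto_at_iff_sequentially comp_def
        using LIMSEQ_inverse_real_of_nat by (simp del: of_nat_Suc)
    qed
    show "AE z in lborel. norm (q m z) \<le> B * indicator (cball 0 (R + 1)) z" for m
    proof (rule AE_I2)
      fix z :: "real^'d"
      let ?h = "inverse (real (Suc m))"
      have "?h > 0" by simp
      have "\<exists>s>0. s < ?h \<and> f (z + ?h *\<^sub>R axis j 1) - f (z + 0 *\<^sub>R axis j 1) = (?h - 0) * partial_deriv j f (z + s *\<^sub>R axis j 1)"
        by (rule MVT2) (use has_real_derivative_along_axis[OF test_function_differentiable[OF f]] in \<open>auto simp del: of_nat_Suc\<close>)
      then obtain s where "q m z = partial_deriv j f (z + s *\<^sub>R axis j 1)"
        by (auto simp: q_def)
      then have "norm (q m z) \<le> B" using B by simp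
      moreover have "q m z = 0" if "z \<notin> cball 0 (R + 1)"
      proof -
        have "norm (?h *\<^sub>R axis j 1 :: real^'d) \<le> 1"
          by (simp add: field_simps)
        then have "norm (z + ?h *\<^sub>R axis j 1) > R"
          using that norm_triangle_ineq4[of "z + ?h *\<^sub>R axis j 1" "?h *\<^sub>R axis j 1"] by simp
        then show ?thesis using R(2)[of "z + ?h *\<^sub>R axis j 1"] R(2)[of z] that R(1) unfolding q_def by force
      qed
      ultimately show "norm (q m z) \<le> B * indicator (cball 0 (R + 1)) z"
        by (cases "z \<in> cball 0 (R + 1)") auto
    qed
  qed (auto simp: q_def)
  moreover have "(\<integral>z. q m z \<partial>lborel) = 0" for m
  proof -
    have "integrable (distr lborel borel ((+) c)) f" for c
      using test_function_integrable_lborel[OF f] by (simp add: lborel_distr_plus)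
    then have int: "integrable lborel (\<lambda>z. f (c + z))" for c
      by (subst (asm) integrable_distr_eq) auto
    have "(\<integral>z. f (c + z) \<partial>lborel) = (\<integral>z. f z \<partial>lborel)" for c
      using integral_distr[of "(+) c" lborel borel f] by (simp add: lborel_distr_plus)
    then have "(\<integral>z. f (z + c) - f z \<partial>lborel) = 0" for c
      using int[of c] test_function_integrable_lborel[OF f] by (simp add: add.commute[of _ c])
    then show ?thesis by (simp add: q_def del: of_nat_Suc)
  qed
  ultimately show ?thesis by (simp add: LIMSEQ_const_iff)
qed

lemma std_gaussian_density_eq:
  "std_gaussian_density (x::real^'d) = (1 / sqrt (2 * pi)) ^ CARD('d) * exp (- (x \<bullet> x) / 2)"
  by (simp add: std_gaussian_density_def std_normal_density_def inner_vec_def prod.distrib exp_sum[symmetric]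
     sum_negf sum_divide_distrib power2_eq_square prod_dividef power_one_over)

lemma C_k_std_gaussian_density: "C_k k (std_gaussian_density :: real^'d \<Rightarrow> real)"
proof -
  have "C_k k (\<lambda>x::real^'d. \<Prod>i\<in>UNIV. (1 / sqrt (2 * pi)) * exp (- (x $ i)\<^sup>2 / 2))"
    by (intro C_k_prod C_k_mult C_k_const C_k_coord[OF smooth_exp_neg_square]) auto
  then show ?thesis
    by (simp add: std_gaussian_density_def[abs_def] std_normal_density_def)
qed

lemma partial_deriv_std_gaussian_density:
  fixes x :: "real^'d"
  shows "partial_deriv j std_gaussian_density x = - (x $ j) * std_gaussian_density x"
proof -
  have "(std_gaussian_density has_derivative
      (\<lambda>h. (1 / sqrt (2 * pi)) ^ CARD('d) * (exp (- (x \<bullet> x) / 2) * (- (x \<bullet> h))))) (at x)"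
    unfolding std_gaussian_density_eq[abs_def]
    by (auto intro!: derivative_eq_intros simp: inner_commute)
  from partial_deriv_eq[OF this] show ?thesis by (simp add: inner_axis std_gaussian_density_eq)
qed

lemma std_gaussian_density_nonneg: "0 \<le> std_gaussian_density x"
  by (simp add: std_gaussian_density_eq)

text \<open>The product of the density and \<open>\<phi>\<close> is again a test function, so its
  partial derivative integrates to 0; the derivative of the density contributes the factor
  \<open>- x $ j\<close>.\<close>

lemma std_gaussian_integration_by_parts:
  fixes \<phi> :: "real^'d \<Rightarrow> real"
  assumes \<phi>: "test_function \<phi>"
  shows "(\<integral>x. std_gaussian_density x * partial_deriv j \<phi> x \<partial>lborel)
    = (\<integral>x. std_gaussian_density x * (\<phi> x * x $ j) \<partial>lborel)"
proof -
  let ?g = "std_gaussian_density :: real^'d \<Rightarrow> real"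
  have t: "test_function (\<lambda>x. ?g x * \<phi> x)"
    by (intro test_function_mult C_k_std_gaussian_density \<phi>)
  have i1: "integrable lborel (\<lambda>x. ?g x * partial_deriv j \<phi> x)"
    by (intro test_function_integrable_lborel test_function_mult C_k_std_gaussian_density test_function_partial_deriv \<phi>)
  have i2: "integrable lborel (\<lambda>x. ?g x * (x $ j * \<phi> x))"
    by (intro test_function_integrable_lborel test_function_mult C_k_std_gaussian_density C_k_coord smooth_real_id \<phi>)
  have "?g differentiable (at x)" for x
    using C_k_std_gaussian_density[where 'd='d, of "Suc 0"] by simp
  then have "partial_deriv j (\<lambda>x. ?g x * \<phi> x) = (\<lambda>x. ?g x * partial_deriv j \<phi> x - ?g x * (x $ j * \<phi> x))"
    by (auto simp: partial_deriv_mult test_function_differentiable \<phi> partial_deriv_std_gaussian_density)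
  then show ?thesis
    using integral_partial_deriv_eq_0[OF t, of j] i1 i2 by (simp add: mult.commute)
qed

subsection \<open>Conditional expectations determined by test functions\<close>

lemma integrable_bounded_mult:
  fixes f g :: "'a \<Rightarrow> real"
  assumes "integrable M g" "f \<in> borel_measurable M" "\<And>x. \<bar>f x\<bar> \<le> B"
  shows "integrable M (\<lambda>x. f x * g x)"
proof (rule Bochner_Integration.integrable_bound)
  show "integrable M (\<lambda>x. B * g x)" using assms by simp
  have "\<bar>f x\<bar> \<le> \<bar>B\<bar>" for x using assms(3)[of x] by linarith
  then show "AE x in M. norm (f x * g x) \<le> norm (B * g x)"
    by (intro AE_I2) (simp add: abs_mult mult_right_mono)
qed (use assms in auto)

lemma integrable_mult_of_squares:
  fixes f g :: "'a \<Rightarrow> real"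
  assumes "integrable M (\<lambda>x. (f x)\<^sup>2)" "integrable M (\<lambda>x. (g x)\<^sup>2)"
    "f \<in> borel_measurable M" "g \<in> borel_measurable M"
  shows "integrable M (\<lambda>x. f x * g x)"
proof (rule Bochner_Integration.integrable_bound)
  show "integrable M (\<lambda>x. (f x)\<^sup>2 + (g x)\<^sup>2)" using assms by simp
  have le: "\<bar>f x * g x\<bar> \<le> (f x)\<^sup>2 + (g x)\<^sup>2" for x
  proof -
    have "2 * \<bar>f x * g x\<bar> \<le> (f x)\<^sup>2 + (g x)\<^sup>2"
      using sum_squares_bound[of "\<bar>f x\<bar>" "\<bar>g x\<bar>"] by (simp add: abs_mult mult.assoc)
    then show ?thesis using abs_ge_zero[of "f x * g x"] by linarith
  qed
  show "AE x in M. norm (f x * g x) \<le> norm ((f x)\<^sup>2 + (g x)\<^sup>2)"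
    by (rule AE_I2) (simp add: le)
qed (use assms in auto)

text \<open>Integrability of the limit is a conclusion here: in this way second moments are shown
  finite from uniform bounds on truncations.\<close>

lemma Fatou_integral_bound:
  fixes f :: "nat \<Rightarrow> 'a \<Rightarrow> real"
  assumes int: "\<And>n. integrable M (f n)" and nonneg: "\<And>n x. 0 \<le> f n x"
    and lim: "\<And>x. (\<lambda>n. f n x) \<longlonglongrightarrow> F x" and bound: "\<And>n. (\<integral>x. f n x \<partial>M) \<le> C"
  shows "integrable M F" "(\<integral>x. F x \<partial>M) \<le> C"
proof -
  have [measurable]: "F \<in> borel_measurable M"
    by (rule borel_measurable_LIMSEQ_real[OF lim]) (use int in auto)
  have pos: "0 \<le> F x" for x using LIMSEQ_le_const[OF lim] nonneg by blast
  have "(\<integral>\<^sup>+x. ennreal (F x) \<partial>M) = (\<integral>\<^sup>+x. liminf (\<lambda>n. ennreal (f n x)) \<partial>M)"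
    by (intro nn_integral_cong lim_imp_Liminf[symmetric] tendsto_ennrealI lim) simp
  also have "\<dots> \<le> liminf (\<lambda>n. \<integral>\<^sup>+x. ennreal (f n x) \<partial>M)"
    using int by (intro nn_integral_liminf) auto
  also have "\<dots> \<le> ennreal C"
    by (rule Liminf_le) (auto simp: nn_integral_eq_integral int nonneg bound ennreal_leI)
  finally have le: "(\<integral>\<^sup>+x. ennreal (F x) \<partial>M) \<le> ennreal C" .
  show "integrable M F"
    by (rule integrableI_nonneg) (use pos le in \<open>auto intro: le_less_trans\<close>)
  have "0 \<le> (\<integral>x. f 0 x \<partial>M)" using nonneg by simp
  with bound[of 0] have "0 \<le> C" by simp
  have "(\<integral>x. F x \<partial>M) = enn2real (\<integral>\<^sup>+x. ennreal (F x) \<partial>M)"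
    by (rule integral_eq_nn_integral) (simp_all add: pos)
  also have "\<dots> \<le> C" using enn2real_leI[OF \<open>0 \<le> C\<close> le] .
  finally show "(\<integral>x. F x \<partial>M) \<le> C" .
qed

text \<open>Bumps converge to indicators of boxes, so \<open>d\<close> integrates to 0 over every
  box. Boxes are stable under intersection and generate the Borel sets, which forces
  \<open>d = 0\<close> almost everywhere on each large cube, and countably many cubes cover the
  space.\<close>

lemma AE_eq_0_if_test_integrals_eq_0:
  fixes d :: "real^'d \<Rightarrow> real"
  assumes P: "sets P = sets borel" and [measurable]: "d \<in> borel_measurable borel"
    and int: "\<And>\<phi>. test_function \<phi> \<Longrightarrow> integrable P (\<lambda>x. \<phi> x * d x)"
    and zero: "\<And>\<phi>. test_function \<phi> \<Longrightarrow> (\<integral>x. \<phi> x * d x \<partial>P) = 0"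
  shows "AE x in P. d x = 0"
proof -
  note [measurable_cong] = P
  have box_int: "integrable P (\<lambda>x. indicator (box a b) x * d x)" (is ?A)
    and box_zero: "(\<integral>x. indicator (box a b) x * d x \<partial>P) = 0" (is ?B) for a b
  proof -
    obtain \<psi> :: "real^'d \<Rightarrow> real" where \<psi>: "test_function \<psi>" "\<And>x. x \<in> cbox a b \<Longrightarrow> 1 \<le> \<psi> x"
      by (rule test_function_ge_1_on_cbox) blast
    \<comment> \<open>\<open>d\<close> itself is not assumed integrable, only its products with test
      functions; \<open>\<psi>\<close>, at least 1 on the closed box, turns one such product into
      the majorant.\<close>
    have w: "integrable P (\<lambda>x. \<bar>\<psi> x * d x\<bar>)" using int[OF \<psi>(1)] by simp
    have [measurable]: "box_bump a b m \<in> borel_measurable borel" for m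
      by (intro test_function_measurable test_function_box_bump)
    have bound: "AE x in P. norm (box_bump a b m x * d x) \<le> \<bar>\<psi> x * d x\<bar>" for m
    proof (rule AE_I2)
      fix x
      have "\<bar>box_bump a b m x\<bar> \<le> \<bar>\<psi> x\<bar>"
      proof (cases "x \<in> box a b")
        case True
        then have "1 \<le> \<psi> x" using \<psi>(2) box_subset_cbox by blast
        then show ?thesis using box_bump_bounds[of a b m x] by simp
      qed (simp add: box_bump_support)
      then show "norm (box_bump a b m x * d x) \<le> \<bar>\<psi> x * d x\<bar>"
        by (simp add: abs_mult mult_right_mono)
    qed
    have lim: "AE x in P. (\<lambda>m. box_bump a b m x * d x) \<longlonglongrightarrow> indicator (box a b) x * d x"
      by (intro AE_I2 tendsto_intros box_bump_tendsto)
    show ?A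
      by (rule integrable_dominated_convergence[OF _ _ w lim bound]) auto
    have "(\<lambda>m. \<integral>x. box_bump a b m x * d x \<partial>P) \<longlonglongrightarrow> (\<integral>x. indicator (box a b) x * d x \<partial>P)"
      by (rule integral_dominated_convergence[OF _ _ w lim bound]) auto
    then show ?B by (simp add: zero test_function_box_bump LIMSEQ_const_iff)
  qed
  have "AE x in P. indicator (box (- (real n *\<^sub>R One)) (real n *\<^sub>R One)) x * d x = 0" for n :: nat
  proof -
    let ?Q = "box (- (real n *\<^sub>R One)) (real n *\<^sub>R One) :: (real^'d) set"
    let ?f = "\<lambda>x. indicator ?Q x * d x"
    have f: "integrable P ?f" by (rule box_int)
    show ?thesis
    \<comment> \<open>The signed density \<open>?f\<close> is compared with the density 0: equal
      integrals over all measurable sets give equality almost everywhere. Cutting \<open>d\<close>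
      off at the cube \<open>?Q\<close> has made it integrable.\<close>
    proof (rule density_unique_real[OF f integrable_zero])
      fix A assume A: "A \<in> sets P"
      have Int: "Int_stable (range (\<lambda>(a, b). box a b :: (real^'d) set))"
        by (auto simp: Int_stable_def box_Int_box)
      moreover have "range (\<lambda>(a, b). box a b :: (real^'d) set) \<subseteq> Pow UNIV" by simp
      moreover have "A \<in> sigma_sets UNIV (range (\<lambda>(a, b). box a b :: (real^'d) set))"
        using A unfolding P borel_eq_box by simp
      ultimately have "(LINT x:A|P. ?f x) = 0"
      proof (induction rule: sigma_sets_induct_disjoint)
        case (basic A)
        then obtain a b where A: "A = box a b" by auto
        have "\<exists>a' b'. A \<inter> ?Q = box a' b'" unfolding A by (intro exI) (rule box_Int_box)
        then obtain a' b' where "A \<inter> ?Q = box a' b'" by (elim exE)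
        moreover have "(LINT x:A|P. ?f x) = (\<integral>x. indicator (A \<inter> ?Q) x * d x \<partial>P)"
          by (simp add: set_lebesgue_integral_def indicator_inter_arith mult.assoc)
        ultimately show ?case using box_zero[of a' b'] by (simp only:)
      next
        case empty
        then show ?case by (simp add: set_lebesgue_integral_def)
      next
        case (compl A)
        then have "A \<in> sets P" by (simp add: borel_eq_box P)
        then have "integrable P (\<lambda>x. indicator A x * ?f x)"
          using integrable_mult_indicator[OF _ f, of A] by simp
        \<comment> \<open>The integral of \<open>?f\<close> over the whole space is itself a box
          integral and hence 0, so passing to the complement costs nothing.\<close>
        then have "(\<integral>x. ?f x - indicator A x * ?f x \<partial>P) = 0"
          using f compl.IH box_zero by (simp add: set_lebesgue_integral_def)
        then show ?case by (simp add: set_lebesgue_integral_def indicator_diff algebra_simps)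
      next
        case (union A)
        have A: "A i \<in> sets P" for i using union.hyps(2) by (auto simp: borel_eq_box P)
        have "set_integrable P (\<Union>i. A i) ?f"
          unfolding set_integrable_def using f A by (intro integrable_mult_indicator sets.countable_UN) auto
        then have "(LINT x:(\<Union>i. A i)|P. ?f x) = (\<Sum>i. (LINT x:(A i)|P. ?f x))"
          using union.hyps(1) A by (intro lebesgue_integral_countable_add) (auto simp: disjoint_family_on_def)
        then show ?case using union.IH by simp
      qed
      then show "(LINT x:A|P. ?f x) = (LINT x:A|P. 0)" by (simp add: set_lebesgue_integral_def)
    qed
  qed
  then have "AE x in P. \<forall>n::nat. indicator (box (- (real n *\<^sub>R One)) (real n *\<^sub>R One)) x * d x = 0"
    unfolding AE_all_countable by (rule allI)
  then show ?thesis
  proof eventually_elim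
    case (elim x)
    have "x \<in> (\<Union>n::nat. box (- (real n *\<^sub>R One)) (real n *\<^sub>R One))"
      unfolding UN_box_eq_UNIV by simp
    then obtain n :: nat where "x \<in> box (- (real n *\<^sub>R One)) (real n *\<^sub>R One)"
      by (elim UN_E)
    then show ?case using elim[rule_format, of n] by simp
  qed
qed

section \<open>Conditional expectations as functions of the conditioning variable\<close>

text \<open>\<open>g\<close> is the Radon-Nikodym derivative, with respect to the law of
  \<open>V\<close>, of the image under \<open>V\<close> of the measure with density
  \<open>h\<close>. This produces a function on the target space directly, the form in which scores
  are represented.\<close>

lemma (in prob_space) conditional_expectation_nonneg:
  fixes h :: "'a \<Rightarrow> real"
  assumes [measurable]: "V \<in> measurable M N" and h: "integrable M h" "\<And>x. 0 \<le> h x"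
  obtains g where "g \<in> borel_measurable N" "integrable M (\<lambda>x. g (V x))"
    "\<And>\<phi>::_ \<Rightarrow> real. \<phi> \<in> borel_measurable N \<Longrightarrow> (\<integral>x. \<phi> (V x) * h x \<partial>M) = (\<integral>x. \<phi> (V x) * g (V x) \<partial>M)"
proof -
  have [measurable]: "h \<in> borel_measurable M" using h by auto
  define P where "P = distr M N V"
  define Q where "Q = distr (density M h) N V"
  interpret P: prob_space P unfolding P_def by (rule prob_space_distr) simp
  have [measurable_cong]: "sets P = sets N" "sets Q = sets N" by (simp_all add: P_def Q_def)
  have "finite_measure Q"
  proof (rule finite_measureI)
    have "emeasure Q (space Q) = (\<integral>\<^sup>+x. ennreal (h x) * indicator (V -` space N \<inter> space M) x \<partial>M)"
      by (simp add: Q_def emeasure_distr emeasure_density)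
    also have "\<dots> \<le> (\<integral>\<^sup>+x. h x \<partial>M)" by (intro nn_integral_mono) (auto simp: indicator_def)
    also have "\<dots> < \<infinity>" using h by (simp add: nn_integral_eq_integral)
    finally show "emeasure Q (space Q) \<noteq> \<infinity>" by simp
  qed
  moreover have "absolutely_continuous P Q"
  proof (unfold absolutely_continuous_def, rule subsetI)
    fix A assume "A \<in> null_sets P"
    then have A[measurable]: "A \<in> sets N" "emeasure M (V -` A \<inter> space M) = 0"
      by (auto simp: P_def null_sets_def emeasure_distr)
    then have "AE x in M. x \<notin> V -` A \<inter> space M"
      by (intro AE_not_in) (auto simp: null_sets_def)
    then have "(\<integral>\<^sup>+x. ennreal (h x) * indicator (V -` A \<inter> space M) x \<partial>M) = 0"
      by (subst nn_integral_0_iff_AE) (auto elim!: eventually_mono)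
    then have "emeasure Q A = 0"
      by (simp add: Q_def emeasure_distr emeasure_density)
    then show "A \<in> null_sets Q" using A(1) by (auto simp: Q_def)
  qed
  moreover have "sets Q = sets P" by (simp add: P_def Q_def)
  ultimately obtain D where [measurable]: "D \<in> borel_measurable P"
    and D: "AE x in P. RN_deriv P Q x = ennreal (D x)" "\<And>x. 0 \<le> D x"
    by (rule P.real_RN_deriv) blast
  have [measurable]: "D \<in> borel_measurable N" by measurable
  have "density P (RN_deriv P Q) = Q"
    by (rule P.density_RN_deriv) fact+
  moreover have "density P (RN_deriv P Q) = density P D"
    by (rule density_cong[OF _ _ D(1)]) auto
  ultimately have Q: "Q = density P D" by simp
  have eq: "(\<integral>x. \<phi> (V x) * h x \<partial>M) = (\<integral>x. \<phi> (V x) * D (V x) \<partial>M)"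
    if [measurable]: "\<phi> \<in> borel_measurable N" for \<phi> :: "_ \<Rightarrow> real"
  proof -
    have "(\<integral>x. \<phi> (V x) * h x \<partial>M) = (\<integral>x. \<phi> x \<partial>Q)"
      using h unfolding Q_def by (subst integral_distr) (auto simp: integral_density mult.commute)
    also have "\<dots> = (\<integral>x. D x * \<phi> x \<partial>P)"
      unfolding Q using D by (subst integral_density) auto
    also have "\<dots> = (\<integral>x. \<phi> (V x) * D (V x) \<partial>M)"
      unfolding P_def by (subst integral_distr) (auto simp: mult.commute)
    finally show ?thesis .
  qed
  have "integrable Q (\<lambda>x. 1::real)" using \<open>finite_measure Q\<close> by (simp add: finite_measure.integrable_const)
  then have "integrable P (\<lambda>x. D x)"
    unfolding Q using D by (subst (asm) integrable_density) auto
  then have "integrable M (\<lambda>x. D (V x))"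
    unfolding P_def by (subst (asm) integrable_distr_eq) auto
  then show ?thesis using that[of D] eq by simp
qed

text \<open>Positive and negative parts are treated separately; boundedness of \<open>\<phi>\<close>
  makes all the products integrable, so that the two identities may be subtracted.\<close>

lemma (in prob_space) conditional_expectation:
  fixes h :: "'a \<Rightarrow> real"
  assumes [measurable]: "V \<in> measurable M N" and h: "integrable M h"
  obtains g where "g \<in> borel_measurable N" "integrable M (\<lambda>x. g (V x))"
    "\<And>\<phi> B. \<phi> \<in> borel_measurable N \<Longrightarrow> (\<And>x. \<bar>\<phi> x\<bar> \<le> B) \<Longrightarrow> (\<integral>x. \<phi> (V x) * h x \<partial>M) = (\<integral>x. \<phi> (V x) * g (V x) \<partial>M)"
proof -
  have p: "integrable M (\<lambda>x. max (h x) 0)" "integrable M (\<lambda>x. max (- h x) 0)" using h by auto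
  obtain g1 where g1: "g1 \<in> borel_measurable N" "integrable M (\<lambda>x. g1 (V x))"
    "\<And>\<phi>::_ \<Rightarrow> real. \<phi> \<in> borel_measurable N \<Longrightarrow> (\<integral>x. \<phi> (V x) * max (h x) 0 \<partial>M) = (\<integral>x. \<phi> (V x) * g1 (V x) \<partial>M)"
    by (rule conditional_expectation_nonneg[OF assms(1) p(1)]) auto
  obtain g2 where g2: "g2 \<in> borel_measurable N" "integrable M (\<lambda>x. g2 (V x))"
    "\<And>\<phi>::_ \<Rightarrow> real. \<phi> \<in> borel_measurable N \<Longrightarrow> (\<integral>x. \<phi> (V x) * max (- h x) 0 \<partial>M) = (\<integral>x. \<phi> (V x) * g2 (V x) \<partial>M)"
    by (rule conditional_expectation_nonneg[OF assms(1) p(2)]) auto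
  show ?thesis
  proof (rule that[of "\<lambda>y. g1 y - g2 y"])
    fix \<phi> :: "_ \<Rightarrow> real" and B
    assume \<phi>[measurable]: "\<phi> \<in> borel_measurable N" and B: "\<And>x. \<bar>\<phi> x\<bar> \<le> B"
    note i = integrable_bounded_mult[of M _ "\<lambda>x. \<phi> (V x)" B]
    have "h x = max (h x) 0 - max (- h x) 0" for x by auto
    then have "(\<integral>x. \<phi> (V x) * h x \<partial>M) = (\<integral>x. \<phi> (V x) * max (h x) 0 - \<phi> (V x) * max (- h x) 0 \<partial>M)"
      by (metis right_diff_distrib)
    also have "\<dots> = (\<integral>x. \<phi> (V x) * g1 (V x) - \<phi> (V x) * g2 (V x) \<partial>M)"
      using i[OF p(1)] i[OF p(2)] i[OF g1(2)] i[OF g2(2)] B g1(3)[OF \<phi>] g2(3)[OF \<phi>] by simp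
    finally show "(\<integral>x. \<phi> (V x) * h x \<partial>M) = (\<integral>x. \<phi> (V x) * (g1 (V x) - g2 (V x)) \<partial>M)"
      by (simp add: right_diff_distrib)
  qed (use g1 g2 in auto)
qed

text \<open>The hypotheses identify \<open>g(V)\<close> with the conditional expectation
  \<open>e(V)\<close> of \<open>h\<close>, and conditional expectation contracts \<open>L^2\<close>.
  Square integrability of \<open>g(V)\<close> is part of the conclusion, so \<open>e\<close> is
  first truncated.\<close>

lemma (in prob_space) square_integral_le_of_test_identity:
  fixes V :: "'a \<Rightarrow> real^'d" and h :: "'a \<Rightarrow> real"
  assumes [measurable]: "V \<in> borel_measurable M" "g \<in> borel_measurable borel" "h \<in> borel_measurable M"
    and h2: "integrable M (\<lambda>x. (h x)\<^sup>2)"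
    and int: "\<And>\<phi>. test_function \<phi> \<Longrightarrow> integrable M (\<lambda>x. \<phi> (V x) * g (V x))"
    and eq: "\<And>\<phi>. test_function \<phi> \<Longrightarrow> (\<integral>x. \<phi> (V x) * g (V x) \<partial>M) = (\<integral>x. \<phi> (V x) * h x \<partial>M)"
  shows "integrable M (\<lambda>x. (g (V x))\<^sup>2)" "(\<integral>x. (g (V x))\<^sup>2 \<partial>M) \<le> (\<integral>x. (h x)\<^sup>2 \<partial>M)"
proof -
  have h: "integrable M h" using h2 by (rule square_integrable_imp_integrable[rotated]) simp
  obtain e where e[measurable]: "e \<in> borel_measurable borel" and e_int: "integrable M (\<lambda>x. e (V x))"
    and e_eq: "\<And>\<phi> B. \<phi> \<in> borel_measurable borel \<Longrightarrow> (\<And>x. \<bar>\<phi> x\<bar> \<le> B) \<Longrightarrow> (\<integral>x. \<phi> (V x) * h x \<partial>M) = (\<integral>x. \<phi> (V x) * e (V x) \<partial>M)"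
    using conditional_expectation[OF assms(1) h] by blast
  define P where "P = distr M borel V"
  have "AE y in P. g y - e y = 0"
  proof (rule AE_eq_0_if_test_integrals_eq_0)
    fix \<phi> :: "real^'d \<Rightarrow> real" assume \<phi>: "test_function \<phi>"
    note [measurable] = test_function_measurable[OF \<phi>]
    obtain B where B: "\<And>x. \<bar>\<phi> x\<bar> \<le> B" using test_function_bounded[OF \<phi>] by blast
    have i: "integrable M (\<lambda>x. \<phi> (V x) * e (V x))"
      by (rule integrable_bounded_mult[OF e_int]) (use B in auto)
    show "integrable P (\<lambda>y. \<phi> y * (g y - e y))"
      unfolding P_def using i int[OF \<phi>] by (subst integrable_distr_eq) (auto simp: right_diff_distrib)
    show "(\<integral>y. \<phi> y * (g y - e y) \<partial>P) = 0"
      unfolding P_def using i int[OF \<phi>] e_eq[of \<phi> B] eq[OF \<phi>] B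
      by (subst integral_distr) (auto simp: right_diff_distrib)
  qed (auto simp: P_def)
  then have AE: "AE x in M. g (V x) = e (V x)"
    unfolding P_def by (subst (asm) AE_distr_iff) auto
  \<comment> \<open>Large values are set to 0 and not clipped, so that
    \<open>\<psi>^2 = \<psi> e\<close> holds exactly; being bounded, \<open>\<psi>\<close> is
    admissible in \<open>e_eq\<close>.\<close>
  define \<psi> where "\<psi> k y = (if \<bar>e y\<bar> \<le> real k then e y else 0)" for k y
  have [measurable]: "\<psi> k \<in> borel_measurable borel" for k by (simp add: \<psi>_def[abs_def])
  have \<psi>_bound: "\<bar>\<psi> k y\<bar> \<le> real k" for k y by (auto simp: \<psi>_def)
  have i1: "integrable M (\<lambda>x. (\<psi> k (V x))\<^sup>2)" for k
  proof (rule integrable_const_bound)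
    have "(\<psi> k y)\<^sup>2 \<le> (real k)\<^sup>2" for y
      using \<psi>_bound[of k y] abs_le_square_iff[of "\<psi> k y" "real k"] by simp
    then show "AE x in M. norm ((\<psi> k (V x))\<^sup>2) \<le> (real k)\<^sup>2" by simp
  qed simp
  have i2: "integrable M (\<lambda>x. \<psi> k (V x) * h x)" for k
    by (rule integrable_bounded_mult[OF h]) (use \<psi>_bound in auto)
  have bound: "(\<integral>x. (\<psi> k (V x))\<^sup>2 \<partial>M) \<le> (\<integral>x. (h x)\<^sup>2 \<partial>M)" for k
  proof -
    have "(\<integral>x. (\<psi> k (V x))\<^sup>2 \<partial>M) = (\<integral>x. \<psi> k (V x) * e (V x) \<partial>M)"
      by (rule Bochner_Integration.integral_cong) (auto simp: \<psi>_def power2_eq_square)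
    also have "\<dots> = (\<integral>x. \<psi> k (V x) * h x \<partial>M)"
      by (rule e_eq[symmetric]) (use \<psi>_bound in auto)
    \<comment> \<open>\<open>2xy \<le> x^2 + y^2\<close> stands in for Cauchy-Schwarz: half of the
      finite integral of \<open>\<psi>^2\<close> is absorbed on the left.\<close>
    also have "\<dots> \<le> (\<integral>x. ((\<psi> k (V x))\<^sup>2 + (h x)\<^sup>2) / 2 \<partial>M)"
      using i1[of k] i2[of k] h2 sum_squares_bound[of "\<psi> k (V _)" "h _"]
      by (intro integral_mono) (auto simp: algebra_simps)
    finally show ?thesis using i1[of k] h2 by simp
  qed
  have lim: "(\<lambda>k. (\<psi> k (V x))\<^sup>2) \<longlonglongrightarrow> (e (V x))\<^sup>2" for x
  proof (rule tendsto_eventually)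
    obtain k0 :: nat where "\<bar>e (V x)\<bar> \<le> real k0" using real_arch_simple by blast
    then show "\<forall>\<^sub>F k in sequentially. (\<psi> k (V x))\<^sup>2 = (e (V x))\<^sup>2"
      by (intro eventually_sequentiallyI[of k0]) (auto simp: \<psi>_def)
  qed
  note F = Fatou_integral_bound[OF i1 _ lim bound]
  have AE2: "AE x in M. (g (V x))\<^sup>2 = (e (V x))\<^sup>2" using AE by eventually_elim simp
  show "integrable M (\<lambda>x. (g (V x))\<^sup>2)"
    using F(1) by (subst integrable_cong_AE[OF _ _ AE2]) auto
  show "(\<integral>x. (g (V x))\<^sup>2 \<partial>M) \<le> (\<integral>x. (h x)\<^sup>2 \<partial>M)"
    using F(2) by (subst integral_cong_AE[OF _ _ AE2]) auto
qed

subsection \<open>Scores and Stein matrices\<close>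

lemma borel_measurable_vec_nth [measurable (raw)]:
  fixes f :: "'a \<Rightarrow> 'b::real_normed_vector^'n"
  assumes "f \<in> borel_measurable M"
  shows "(\<lambda>x. f x $ i) \<in> borel_measurable M"
  by (rule measurable_compose[OF assms])
    (intro borel_measurable_continuous_onI continuous_intros)

lemma integrable_vec_nth:
  fixes f :: "'a \<Rightarrow> 'b::euclidean_space^'n"
  assumes "integrable M f"
  shows "integrable M (\<lambda>x. f x $ i)" "(\<integral>x. f x $ i \<partial>M) = (\<integral>x. f x \<partial>M) $ i"
  using integrable_bounded_linear[OF bounded_linear_vec_nth assms]
    integral_bounded_linear[OF bounded_linear_vec_nth assms] by auto

lemma integrable_vec_componentwise:
  fixes f :: "'a \<Rightarrow> 'b::euclidean_space^'n"
  assumes "\<And>i. integrable M (\<lambda>x. f x $ i)"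
  shows "integrable M f"
proof -
  have "bounded_linear (axis i :: 'b \<Rightarrow> 'b^'n)" for i
    by (rule linear_conv_bounded_linear[THEN iffD1], rule linearI) (auto simp: axis_def vec_eq_iff)
  then have "integrable M (\<lambda>x. \<Sum>i\<in>UNIV. axis i (f x $ i))"
    by (intro Bochner_Integration.integrable_sum integrable_bounded_linear[OF _ assms])
  moreover have "(\<Sum>i\<in>UNIV. axis i (v $ i)) = v" for v :: "'b^'n"
    by (simp add: vec_eq_iff axis_def if_distrib cong: if_cong)
  ultimately show ?thesis by simp
qed

lemma is_scoreD:
  fixes V :: "'a \<Rightarrow> real^'d"
  assumes "is_score M V \<rho>" "test_function \<phi>"
  shows "integrable M (\<lambda>\<omega>. \<phi> (V \<omega>) * \<rho> (V \<omega>) $ j)"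
    and "(\<integral>\<omega>. \<phi> (V \<omega>) * \<rho> (V \<omega>) $ j \<partial>M) = - (\<integral>\<omega>. partial_deriv j \<phi> (V \<omega>) \<partial>M)"
proof -
  have i: "integrable M (\<lambda>\<omega>. \<phi> (V \<omega>) *\<^sub>R \<rho> (V \<omega>))" "integrable M (\<lambda>\<omega>. gradient \<phi> (V \<omega>))"
    and e: "(\<integral>\<omega>. \<phi> (V \<omega>) *\<^sub>R \<rho> (V \<omega>) \<partial>M) = - (\<integral>\<omega>. gradient \<phi> (V \<omega>) \<partial>M)"
    using assms by (auto simp: is_score_def)
  show "integrable M (\<lambda>\<omega>. \<phi> (V \<omega>) * \<rho> (V \<omega>) $ j)"
    using integrable_vec_nth(1)[OF i(1), of j] by simp
  show "(\<integral>\<omega>. \<phi> (V \<omega>) * \<rho> (V \<omega>) $ j \<partial>M) = - (\<integral>\<omega>. partial_deriv j \<phi> (V \<omega>) \<partial>M)"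
    using integrable_vec_nth(2)[OF i(1), of j] integrable_vec_nth(2)[OF i(2), of j]
    by (simp add: e gradient_def)
qed

lemma is_stein_matrixD:
  fixes V :: "'a \<Rightarrow> real^'d"
  assumes "is_stein_matrix M V \<tau>" "test_function \<phi>"
  shows "integrable M (\<lambda>\<omega>. \<Sum>k\<in>UNIV. \<tau> (V \<omega>) $ j $ k * partial_deriv k \<phi> (V \<omega>))"
    and "integrable M (\<lambda>\<omega>. \<phi> (V \<omega>) * V \<omega> $ j)"
    and "(\<integral>\<omega>. (\<Sum>k\<in>UNIV. \<tau> (V \<omega>) $ j $ k * partial_deriv k \<phi> (V \<omega>)) \<partial>M) = (\<integral>\<omega>. \<phi> (V \<omega>) * V \<omega> $ j \<partial>M)"
proof -
  have i: "integrable M (\<lambda>\<omega>. \<tau> (V \<omega>) *v gradient \<phi> (V \<omega>))" "integrable M (\<lambda>\<omega>. \<phi> (V \<omega>) *\<^sub>R V \<omega>)"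
    and e: "(\<integral>\<omega>. \<tau> (V \<omega>) *v gradient \<phi> (V \<omega>) \<partial>M) = (\<integral>\<omega>. \<phi> (V \<omega>) *\<^sub>R V \<omega> \<partial>M)"
    using assms by (auto simp: is_stein_matrix_def)
  have eq: "(\<tau> (V \<omega>) *v gradient \<phi> (V \<omega>)) $ j = (\<Sum>k\<in>UNIV. \<tau> (V \<omega>) $ j $ k * partial_deriv k \<phi> (V \<omega>))" for \<omega>
    by (simp add: matrix_vector_mult_def gradient_def)
  show "integrable M (\<lambda>\<omega>. \<Sum>k\<in>UNIV. \<tau> (V \<omega>) $ j $ k * partial_deriv k \<phi> (V \<omega>))"
    using integrable_vec_nth(1)[OF i(1), of j] by (simp add: eq)
  show "integrable M (\<lambda>\<omega>. \<phi> (V \<omega>) * V \<omega> $ j)"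
    using integrable_vec_nth(1)[OF i(2), of j] by simp
  show "(\<integral>\<omega>. (\<Sum>k\<in>UNIV. \<tau> (V \<omega>) $ j $ k * partial_deriv k \<phi> (V \<omega>)) \<partial>M) = (\<integral>\<omega>. \<phi> (V \<omega>) * V \<omega> $ j \<partial>M)"
    using integrable_vec_nth(2)[OF i(1), of j] integrable_vec_nth(2)[OF i(2), of j]
    by (simp add: e eq)
qed

text \<open>Here \<open>\<phi> m x = (m + 1) f (x / (m + 1))\<close> for a test function \<open>f\<close> that agrees with the
  coordinate \<open>x $ k\<close> to first order at \<open>0\<close>.\<close>

lemma test_function_coord_approx:
  fixes k :: "'d::finite"
  obtains \<phi> :: "nat \<Rightarrow> real^'d \<Rightarrow> real" and \<eta> B
  where "\<And>m. test_function (\<phi> m)" "\<And>m x. \<phi> m x = x $ k * \<eta> m x"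
    "\<And>m x. 0 \<le> \<eta> m x" "\<And>m x. \<eta> m x \<le> B" "\<And>x. (\<lambda>m. \<eta> m x) \<longlonglongrightarrow> 1"
    "\<And>m x i. \<bar>partial_deriv i (\<phi> m) x\<bar> \<le> B"
    "\<And>i x. (\<lambda>m. partial_deriv i (\<phi> m) x) \<longlonglongrightarrow> (if i = k then 1 else 0)"
proof -
  define \<beta> where "\<beta> = box_bump (-1) (1::real^'d) 0"
  have b: "test_function \<beta>" by (simp add: \<beta>_def test_function_box_bump)
  have pos: "\<beta> 0 > 0" unfolding \<beta>_def by (rule box_bump_positive) (simp add: mem_box_cart)
  define \<eta> where "\<eta> x = (1 / \<beta> 0) * \<beta> x" for x
  have c: "test_function \<eta>"
    unfolding \<eta>_def[abs_def] by (intro test_function_mult C_k_const b)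
  have c_pos: "0 \<le> \<eta> x" for x
    using pos by (simp add: \<eta>_def \<beta>_def box_bump_bounds)
  have c0: "\<eta> 0 = 1" using pos by (simp add: \<eta>_def)
  define f where "f x = x $ k * \<eta> x" for x
  have f: "test_function f"
    unfolding f_def[abs_def] by (intro test_function_mult C_k_coord smooth_real_id c)
  have "(\<lambda>x::real^'d. x $ k) differentiable (at x)" for x
    by (rule bounded_linear_imp_differentiable) (rule bounded_linear_vec_nth)
  then have f0: "partial_deriv i f 0 = (if i = k then 1 else 0)" for i
    unfolding f_def[abs_def] using test_function_differentiable[OF c]
    by (simp add: partial_deriv_mult partial_deriv_coord[OF DERIV_ident] c0)
  define \<phi> where "\<phi> m x = real (Suc m) * f (inverse (real (Suc m)) *\<^sub>R x + 0)" for m x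
  have t: "test_function (\<lambda>x. f (inverse (real (Suc m)) *\<^sub>R x + 0))" for m
    by (rule test_function_affine[OF f]) simp
  have \<phi>: "test_function (\<phi> m)" for m
    unfolding \<phi>_def[abs_def] by (intro test_function_mult C_k_const t)
  \<comment> \<open>The outer factor \<open>m + 1\<close> cancels the chain rule factor. The
    gradient at \<open>x\<close> is therefore that of \<open>f\<close> at
    \<open>x / (m + 1)\<close>: bounded uniformly in \<open>m\<close> and convergent to the gradient
    at 0.\<close>
  have d\<phi>: "partial_deriv i (\<phi> m) x = partial_deriv i f (inverse (real (Suc m)) *\<^sub>R x)" for i m x
  proof -
    have "partial_deriv i (\<lambda>x::real^'d. real (Suc m)) x = 0"
      by (rule partial_deriv_eq) (rule has_derivative_const)
    then have "partial_deriv i (\<phi> m) x = real (Suc m) * partial_deriv i (\<lambda>x. f (inverse (real (Suc m)) *\<^sub>R x + 0)) x"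
      unfolding \<phi>_def[abs_def] partial_deriv_mult[OF differentiable_const test_function_differentiable[OF t]]
      by simp
    also have "\<dots> = real (Suc m) * (inverse (real (Suc m)) * partial_deriv i f (inverse (real (Suc m)) *\<^sub>R x + 0))"
      by (simp only: partial_deriv_affine[OF test_function_differentiable[OF f]])
    finally show ?thesis by (simp del: of_nat_Suc)
  qed
  have scale: "(\<lambda>m. inverse (real (Suc m)) *\<^sub>R x) \<longlonglongrightarrow> 0" for x :: "real^'d"
    using tendsto_scaleR[OF LIMSEQ_inverse_real_of_nat tendsto_const[of x]] by simp
  have lim: "(\<lambda>m. g (inverse (real (Suc m)) *\<^sub>R x)) \<longlonglongrightarrow> g 0" if "test_function g" for g :: "real^'d \<Rightarrow> real" and x
    using test_function_continuous[OF that] scale[of x]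
    by (auto simp: continuous_on_eq_continuous_within intro: isCont_tendsto_compose)
  have "\<exists>B. \<forall>x. \<bar>partial_deriv i f x\<bar> \<le> B" for i
    using test_function_bounded[OF test_function_partial_deriv[OF f]] by metis
  then obtain Bf where Bf: "\<And>i x. \<bar>partial_deriv i f x\<bar> \<le> Bf i" by metis
  obtain Bc where Bc: "Bc \<ge> 0" "\<And>x. \<bar>\<eta> x\<bar> \<le> Bc" by (rule test_function_bounded[OF c]) blast
  have Bf_pos: "0 \<le> Bf i" for i using Bf[of i 0] by linarith
  have "Bf i \<le> Bc + sum Bf UNIV" for i
    using member_le_sum[of i UNIV Bf] Bf_pos Bc(1) by fastforce
  then have B1: "\<bar>partial_deriv i f x\<bar> \<le> Bc + sum Bf UNIV" for i x
    using Bf order_trans by blast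
  have B2: "\<eta> x \<le> Bc + sum Bf UNIV" for x
    using Bc(2)[of x] sum_nonneg[of UNIV Bf] Bf_pos by fastforce
  show ?thesis
  proof (rule that[of \<phi> "\<lambda>m x. \<eta> (inverse (real (Suc m)) *\<^sub>R x)" "Bc + sum Bf UNIV"])
    show "\<phi> m x = x $ k * \<eta> (inverse (real (Suc m)) *\<^sub>R x)" for m x
      by (simp add: \<phi>_def f_def field_simps del: of_nat_Suc)
    show "(\<lambda>m. \<eta> (inverse (real (Suc m)) *\<^sub>R x)) \<longlonglongrightarrow> 1" for x
      using lim[OF c] by (simp add: c0)
    show "(\<lambda>m. partial_deriv i (\<phi> m) x) \<longlonglongrightarrow> (if i = k then 1 else 0)" for i x
      unfolding d\<phi> using lim[OF test_function_partial_deriv[OF f], of i x] by (simp only: f0)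
  qed (use \<phi> c_pos B1 B2 in \<open>auto simp: d\<phi> simp del: of_nat_Suc\<close>)
qed

text \<open>The Stein identity for the function \<open>x $ k\<close>, reached through truncated
  coordinates. It yields the covariance of the Gaussian from its Stein matrix \<open>Id\<close> and,
  conversely, the mean of each \<open>\<tau> i\<close> from the covariance of
  \<open>X i\<close>.\<close>

lemma stein_matrix_second_moment:
  fixes V :: "'a \<Rightarrow> real^'d"
  assumes [measurable]: "V \<in> borel_measurable M" and stein: "is_stein_matrix M V \<tau>"
    and \<tau>: "\<And>j k. integrable M (\<lambda>\<omega>. \<tau> (V \<omega>) $ j $ k)"
  shows "integrable M (\<lambda>\<omega>. V \<omega> $ j * V \<omega> $ k)"
    and "(\<integral>\<omega>. V \<omega> $ j * V \<omega> $ k \<partial>M) = (\<integral>\<omega>. \<tau> (V \<omega>) $ j $ k \<partial>M)"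
proof -
  \<comment> \<open>On the diagonal the truncated integrands are nonnegative, and the Stein identity
    bounds their integrals by first moments of \<open>\<tau>\<close>, so Fatou applies. The squares
    then supply the majorant for dominated convergence with general \<open>j\<close> and
    \<open>k\<close>.\<close>
  have sq: "integrable M (\<lambda>\<omega>. (V \<omega> $ k)\<^sup>2)" for k
  proof -
    obtain \<phi> :: "nat \<Rightarrow> real^'d \<Rightarrow> real" and \<eta> B
    where \<phi>: "\<And>m. test_function (\<phi> m)" "\<And>m x. \<phi> m x = x $ k * \<eta> m x"
    and \<eta>: "\<And>m x. 0 \<le> \<eta> m x" "\<And>m x. \<eta> m x \<le> B" "\<And>x. (\<lambda>m. \<eta> m x) \<longlonglongrightarrow> 1"
    and d: "\<And>m x i. \<bar>partial_deriv i (\<phi> m) x\<bar> \<le> B"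
    "\<And>i x. (\<lambda>m. partial_deriv i (\<phi> m) x) \<longlonglongrightarrow> (if i = k then 1 else 0)"
      by (rule test_function_coord_approx) blast
    note st = is_stein_matrixD[OF stein \<phi>(1), where j=k]
    have le: "\<tau> x $ k $ i * partial_deriv i (\<phi> m) x \<le> B * \<bar>\<tau> x $ k $ i\<bar>" for m i x
    proof -
      have "\<tau> x $ k $ i * partial_deriv i (\<phi> m) x \<le> \<bar>\<tau> x $ k $ i\<bar> * \<bar>partial_deriv i (\<phi> m) x\<bar>"
        by (metis abs_ge_self abs_mult)
      also have "\<dots> \<le> \<bar>\<tau> x $ k $ i\<bar> * B" by (intro mult_left_mono d(1)) simp
      finally show ?thesis by (simp add: mult.commute)
    qed
    show ?thesis
    proof (rule Fatou_integral_bound(1))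
      show "integrable M (\<lambda>\<omega>. \<phi> m (V \<omega>) * V \<omega> $ k)" for m by (rule st(2))
      show "0 \<le> \<phi> m (V \<omega>) * V \<omega> $ k" for m \<omega>
      proof -
        have "\<phi> m (V \<omega>) * V \<omega> $ k = \<eta> m (V \<omega>) * (V \<omega> $ k)\<^sup>2"
          by (simp add: \<phi>(2) power2_eq_square)
        then show ?thesis using \<eta>(1)[of m "V \<omega>"] by simp
      qed
      show "(\<lambda>m. \<phi> m (V \<omega>) * V \<omega> $ k) \<longlonglongrightarrow> (V \<omega> $ k)\<^sup>2" for \<omega>
        using tendsto_mult[OF \<eta>(3)[of "V \<omega>"] tendsto_const[of "(V \<omega> $ k)\<^sup>2"]]
        by (simp add: \<phi>(2) power2_eq_square mult_ac)
      show "(\<integral>\<omega>. \<phi> m (V \<omega>) * V \<omega> $ k \<partial>M) \<le> (\<integral>\<omega>. (\<Sum>i\<in>UNIV. B * \<bar>\<tau> (V \<omega>) $ k $ i\<bar>) \<partial>M)" for m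
        unfolding st(3)[symmetric] using \<tau>
        by (intro integral_mono st(1) sum_mono le Bochner_Integration.integrable_sum integrable_mult_right integrable_abs)
    qed
  qed
  show int: "integrable M (\<lambda>\<omega>. V \<omega> $ j * V \<omega> $ k)"
    by (intro integrable_mult_of_squares sq) auto
  obtain \<phi> :: "nat \<Rightarrow> real^'d \<Rightarrow> real" and \<eta> B
  where \<phi>: "\<And>m. test_function (\<phi> m)" "\<And>m x. \<phi> m x = x $ k * \<eta> m x"
  and \<eta>: "\<And>m x. 0 \<le> \<eta> m x" "\<And>m x. \<eta> m x \<le> B" "\<And>x. (\<lambda>m. \<eta> m x) \<longlonglongrightarrow> 1"
  and d: "\<And>m x i. \<bar>partial_deriv i (\<phi> m) x\<bar> \<le> B"
  "\<And>i x. (\<lambda>m. partial_deriv i (\<phi> m) x) \<longlonglongrightarrow> (if i = k then 1 else 0)"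
    by (rule test_function_coord_approx) blast
  note st = is_stein_matrixD[OF stein \<phi>(1), where j=j]
  have m1: "\<phi> m \<in> borel_measurable borel" "partial_deriv i (\<phi> m) \<in> borel_measurable borel" for m i
    by (intro test_function_measurable test_function_partial_deriv \<phi>)+
  note [measurable] = m1 borel_measurable_integrable[OF \<tau>]
  have L1: "(\<lambda>m. \<integral>\<omega>. \<phi> m (V \<omega>) * V \<omega> $ j \<partial>M) \<longlonglongrightarrow> (\<integral>\<omega>. V \<omega> $ j * V \<omega> $ k \<partial>M)"
  proof (rule integral_dominated_convergence)
    show "integrable M (\<lambda>\<omega>. B * \<bar>V \<omega> $ j * V \<omega> $ k\<bar>)" using int by simp
    show "AE \<omega> in M. (\<lambda>m. \<phi> m (V \<omega>) * V \<omega> $ j) \<longlonglongrightarrow> V \<omega> $ j * V \<omega> $ k"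
    proof (rule AE_I2)
      fix \<omega>
      show "(\<lambda>m. \<phi> m (V \<omega>) * V \<omega> $ j) \<longlonglongrightarrow> V \<omega> $ j * V \<omega> $ k"
        using tendsto_mult[OF \<eta>(3)[of "V \<omega>"] tendsto_const[of "V \<omega> $ j * V \<omega> $ k"]]
        by (simp add: \<phi>(2) mult_ac)
    qed
    show "AE \<omega> in M. norm (\<phi> m (V \<omega>) * V \<omega> $ j) \<le> B * \<bar>V \<omega> $ j * V \<omega> $ k\<bar>" for m
    proof (rule AE_I2)
      fix \<omega>
      have "norm (\<phi> m (V \<omega>) * V \<omega> $ j) = \<eta> m (V \<omega>) * \<bar>V \<omega> $ j * V \<omega> $ k\<bar>"
        using \<eta>(1)[of m "V \<omega>"] by (simp add: \<phi>(2) abs_mult)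
      then show "norm (\<phi> m (V \<omega>) * V \<omega> $ j) \<le> B * \<bar>V \<omega> $ j * V \<omega> $ k\<bar>"
        using mult_right_mono[OF \<eta>(2)[of m "V \<omega>"] abs_ge_zero[of "V \<omega> $ j * V \<omega> $ k"]] by simp
    qed
  qed auto
  have L2: "(\<lambda>m. \<integral>\<omega>. (\<Sum>i\<in>UNIV. \<tau> (V \<omega>) $ j $ i * partial_deriv i (\<phi> m) (V \<omega>)) \<partial>M) \<longlonglongrightarrow> (\<integral>\<omega>. \<tau> (V \<omega>) $ j $ k \<partial>M)"
  proof (rule integral_dominated_convergence)
    show "integrable M (\<lambda>\<omega>. \<Sum>i\<in>UNIV. B * \<bar>\<tau> (V \<omega>) $ j $ i\<bar>)"
      using \<tau> by (intro Bochner_Integration.integrable_sum integrable_mult_right integrable_abs)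
    show "AE \<omega> in M. (\<lambda>m. \<Sum>i\<in>UNIV. \<tau> (V \<omega>) $ j $ i * partial_deriv i (\<phi> m) (V \<omega>)) \<longlonglongrightarrow> \<tau> (V \<omega>) $ j $ k"
    proof (rule AE_I2)
      fix \<omega>
      have "(\<lambda>m. \<Sum>i\<in>UNIV. \<tau> (V \<omega>) $ j $ i * partial_deriv i (\<phi> m) (V \<omega>)) \<longlonglongrightarrow> (\<Sum>i\<in>UNIV. \<tau> (V \<omega>) $ j $ i * (if i = k then 1 else 0))"
        by (intro tendsto_intros d(2))
      then show "(\<lambda>m. \<Sum>i\<in>UNIV. \<tau> (V \<omega>) $ j $ i * partial_deriv i (\<phi> m) (V \<omega>)) \<longlonglongrightarrow> \<tau> (V \<omega>) $ j $ k"
        by (simp add: if_distrib cong: if_cong)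
    qed
    show "AE \<omega> in M. norm (\<Sum>i\<in>UNIV. \<tau> (V \<omega>) $ j $ i * partial_deriv i (\<phi> m) (V \<omega>)) \<le> (\<Sum>i\<in>UNIV. B * \<bar>\<tau> (V \<omega>) $ j $ i\<bar>)" for m
    proof (intro AE_I2 order_trans[OF norm_sum] sum_mono)
      fix \<omega> i
      show "norm (\<tau> (V \<omega>) $ j $ i * partial_deriv i (\<phi> m) (V \<omega>)) \<le> B * \<bar>\<tau> (V \<omega>) $ j $ i\<bar>"
        using mult_right_mono[OF d(1)[of i m "V \<omega>"] abs_ge_zero[of "\<tau> (V \<omega>) $ j $ i"]]
        by (simp add: abs_mult mult.commute)
    qed
  qed auto
  show "(\<integral>\<omega>. V \<omega> $ j * V \<omega> $ k \<partial>M) = (\<integral>\<omega>. \<tau> (V \<omega>) $ j $ k \<partial>M)"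
    using LIMSEQ_unique[OF L1] L2 unfolding st(3) by blast
qed

text \<open>Gaussian integration by parts is the Stein identity with constant matrix
  \<open>Id\<close>; \<open>Z\<close> can thus be handled by the same lemmas as the
  \<open>X i\<close>.\<close>

lemma std_gaussian_is_stein_matrix:
  fixes Z :: "'a \<Rightarrow> real^'d"
  assumes D: "distributed M lborel Z (\<lambda>x. ennreal (std_gaussian_density x))"
  shows "is_stein_matrix M Z (\<lambda>_. mat 1)"
  unfolding is_stein_matrix_def
proof (intro conjI allI impI)
  fix \<phi> :: "real^'d \<Rightarrow> real" assume \<phi>: "test_function \<phi>"
  note nn = std_gaussian_density_nonneg
  note dI = distributed_integrable[OF D _ nn] and dE = distributed_integral[OF D _ nn]
  have t: "test_function (partial_deriv j \<phi>)" "test_function (\<lambda>x. x $ j * \<phi> x)" for j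
    by (intro test_function_partial_deriv test_function_mult C_k_coord smooth_real_id \<phi>)+
  have int: "integrable M (\<lambda>\<omega>. f (Z \<omega>))" if "test_function f" for f
    using that by (subst dI[symmetric])
      (auto intro!: test_function_measurable test_function_integrable_lborel test_function_mult C_k_std_gaussian_density)
  have eq: "(\<integral>\<omega>. partial_deriv j \<phi> (Z \<omega>) \<partial>M) = (\<integral>\<omega>. Z \<omega> $ j * \<phi> (Z \<omega>) \<partial>M)" for j
    using std_gaussian_integration_by_parts[OF \<phi>, of j] dE[of "partial_deriv j \<phi>"] dE[of "\<lambda>x. x $ j * \<phi> x"]
      test_function_measurable[OF t(1)[of j]] test_function_measurable[OF t(2)[of j]]
    by (simp add: mult.commute)
  show i1: "integrable M (\<lambda>\<omega>. mat 1 *v gradient \<phi> (Z \<omega>))"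
    by (rule integrable_vec_componentwise) (simp add: gradient_def int t)
  show i2: "integrable M (\<lambda>\<omega>. \<phi> (Z \<omega>) *\<^sub>R Z \<omega>)"
    by (rule integrable_vec_componentwise) (use int[OF t(2)] in \<open>simp add: mult.commute\<close>)
  have "(\<integral>\<omega>. mat 1 *v gradient \<phi> (Z \<omega>) \<partial>M) $ j = (\<integral>\<omega>. \<phi> (Z \<omega>) *\<^sub>R Z \<omega> \<partial>M) $ j" for j
    unfolding integrable_vec_nth(2)[OF i1, symmetric] integrable_vec_nth(2)[OF i2, symmetric]
    using eq[of j] by (simp add: gradient_def mult.commute)
  then show "(\<integral>\<omega>. mat 1 *v gradient \<phi> (Z \<omega>) \<partial>M) = (\<integral>\<omega>. \<phi> (Z \<omega>) *\<^sub>R Z \<omega> \<partial>M)"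
    by (simp add: vec_eq_iff)
qed simp

subsection \<open>Independence\<close>

context prob_space
begin

lemma indep_pairD:
  assumes "indep_pair M S U T V"
  shows "U \<in> measurable M S" "V \<in> measurable M T"
    and "\<And>A B. A \<in> sets S \<Longrightarrow> B \<in> sets T \<Longrightarrow>
      prob ((U -` A \<inter> space M) \<inter> (V -` B \<inter> space M)) = prob (U -` A \<inter> space M) * prob (V -` B \<inter> space M)"
proof -
  from assms show m: "U \<in> measurable M S" "V \<in> measurable M T" by (auto simp: indep_pair_def)
  fix A B assume "A \<in> sets S" "B \<in> sets T"
  then show "prob ((U -` A \<inter> space M) \<inter> (V -` B \<inter> space M)) = prob (U -` A \<inter> space M) * prob (V -` B \<inter> space M)"
    using assms by (intro indep_setD) (auto simp: indep_pair_def)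
qed

lemma indep_pair_distr:
  assumes "indep_pair M S U T V"
  shows "distr M (S \<Otimes>\<^sub>M T) (\<lambda>\<omega>. (U \<omega>, V \<omega>)) = distr M S U \<Otimes>\<^sub>M distr M T V"
proof -
  note ind = indep_pairD[OF assms] and [measurable] = indep_pairD(1,2)[OF assms]
  interpret P: prob_space "distr M S U" by (rule prob_space_distr) simp
  interpret Q: prob_space "distr M T V" by (rule prob_space_distr) simp
  show ?thesis
  proof (rule pair_measure_eqI[symmetric])
    show "sigma_finite_measure (distr M S U)" "sigma_finite_measure (distr M T V)" by unfold_locales
    fix A B assume "A \<in> sets (distr M S U)" "B \<in> sets (distr M T V)"
    then have [measurable]: "A \<in> sets S" "B \<in> sets T" by auto
    have "(\<lambda>\<omega>. (U \<omega>, V \<omega>)) -` (A \<times> B) \<inter> space M = (U -` A \<inter> space M) \<inter> (V -` B \<inter> space M)" by auto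
    then show "emeasure (distr M S U) A * emeasure (distr M T V) B = emeasure (distr M (S \<Otimes>\<^sub>M T) (\<lambda>\<omega>. (U \<omega>, V \<omega>))) (A \<times> B)"
      by (simp add: emeasure_distr emeasure_eq_measure ind(3) ennreal_mult)
  qed (simp cong: sets_pair_measure_cong)
qed

text \<open>Covers pairs with a common value type, giving access to the library results on
  \<open>indep_var\<close>; pairs of different types are first composed into this form.\<close>

lemma indep_pair_iff_indep_var: "indep_pair M S U T V \<longleftrightarrow> indep_var S U T V"
proof
  assume *: "indep_pair M S U T V"
  then show "indep_var S U T V"
    using indep_pair_distr[OF *] indep_pairD(1,2)[OF *] by (simp add: indep_var_distribution_eq)
next
  assume *: "indep_var S U T V"
  then have "U \<in> measurable M S" "V \<in> measurable M T" by (auto intro: indep_var_rv1 indep_var_rv2)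
  moreover have "indep_set {U -` A \<inter> space M | A. A \<in> sets S} {V -` B \<inter> space M | B. B \<in> sets T}"
    using * unfolding indep_var_eq by (auto simp: indep_sets2_eq)
  ultimately show "indep_pair M S U T V" by (simp add: indep_pair_def)
qed

lemma indep_pair_compose:
  assumes "indep_pair M S U T V" and f: "f \<in> measurable S S'" and g: "g \<in> measurable T T'"
  shows "indep_pair M S' (\<lambda>\<omega>. f (U \<omega>)) T' (\<lambda>\<omega>. g (V \<omega>))"
proof -
  note ind = indep_pairD[OF assms(1)] and [measurable] = indep_pairD(1,2)[OF assms(1)] f g
  have eq: "(\<lambda>\<omega>. f (U \<omega>)) -` A \<inter> space M = U -` (f -` A \<inter> space S) \<inter> space M"
    "(\<lambda>\<omega>. g (V \<omega>)) -` B \<inter> space M = V -` (g -` B \<inter> space T) \<inter> space M" for A B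
    using measurable_space[OF ind(1)] measurable_space[OF ind(2)] by auto
  have "indep_set {(\<lambda>\<omega>. f (U \<omega>)) -` A \<inter> space M | A. A \<in> sets S'} {(\<lambda>\<omega>. g (V \<omega>)) -` B \<inter> space M | B. B \<in> sets T'}"
    unfolding indep_sets2_eq
  proof (intro conjI ballI)
    fix a b assume "a \<in> {(\<lambda>\<omega>. f (U \<omega>)) -` A \<inter> space M | A. A \<in> sets S'}" "b \<in> {(\<lambda>\<omega>. g (V \<omega>)) -` B \<inter> space M | B. B \<in> sets T'}"
    then obtain A B where "A \<in> sets S'" "B \<in> sets T'"
      and ab: "a = U -` (f -` A \<inter> space S) \<inter> space M" "b = V -` (g -` B \<inter> space T) \<inter> space M"
      unfolding eq by blast
    then show "prob (a \<inter> b) = prob a * prob b"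
      unfolding ab by (intro ind(3) measurable_sets[OF f] measurable_sets[OF g])
  qed auto
  then show ?thesis by (simp add: indep_pair_def)
qed

text \<open>Fubini on the product law: with \<open>V\<close> frozen at a value \<open>v\<close>,
  only the integrals over \<open>U\<close> have to be compared.\<close>

lemma indep_pair_integral_cong:
  fixes f g :: "'b \<Rightarrow> 'c \<Rightarrow> real"
  assumes ind: "indep_pair M S U T V"
    and [measurable]: "case_prod f \<in> borel_measurable (S \<Otimes>\<^sub>M T)" "case_prod g \<in> borel_measurable (S \<Otimes>\<^sub>M T)"
    and int: "integrable M (\<lambda>\<omega>. f (U \<omega>) (V \<omega>))" "integrable M (\<lambda>\<omega>. g (U \<omega>) (V \<omega>))"
    and eq: "\<And>v. v \<in> space T \<Longrightarrow> (\<integral>\<omega>. f (U \<omega>) v \<partial>M) = (\<integral>\<omega>. g (U \<omega>) v \<partial>M)"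
  shows "(\<integral>\<omega>. f (U \<omega>) (V \<omega>) \<partial>M) = (\<integral>\<omega>. g (U \<omega>) (V \<omega>) \<partial>M)"
proof -
  note [measurable] = indep_pairD(1,2)[OF ind]
  interpret P: prob_space "distr M S U" by (rule prob_space_distr) simp
  interpret Q: prob_space "distr M T V" by (rule prob_space_distr) simp
  interpret pair_sigma_finite "distr M S U" "distr M T V" ..
  have *: "(\<integral>\<omega>. h (U \<omega>) (V \<omega>) \<partial>M) = (\<integral>v. (\<integral>\<omega>. h (U \<omega>) v \<partial>M) \<partial>distr M T V)"
    if [measurable]: "case_prod h \<in> borel_measurable (S \<Otimes>\<^sub>M T)" and i: "integrable M (\<lambda>\<omega>. h (U \<omega>) (V \<omega>))"
    for h :: "'b \<Rightarrow> 'c \<Rightarrow> real"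
  proof -
    have "integrable (distr M (S \<Otimes>\<^sub>M T) (\<lambda>\<omega>. (U \<omega>, V \<omega>))) (case_prod h)"
      using i by (subst integrable_distr_eq) auto
    then have int: "integrable (distr M S U \<Otimes>\<^sub>M distr M T V) (case_prod h)"
      by (simp only: indep_pair_distr[OF ind])
    have "(\<integral>\<omega>. h (U \<omega>) (V \<omega>) \<partial>M) = (\<integral>p. case_prod h p \<partial>distr M (S \<Otimes>\<^sub>M T) (\<lambda>\<omega>. (U \<omega>, V \<omega>)))"
      by (subst integral_distr) auto
    also have "\<dots> = (\<integral>v. (\<integral>u. h u v \<partial>distr M S U) \<partial>distr M T V)"
      unfolding indep_pair_distr[OF ind] by (rule integral_snd[OF int, symmetric])
    also have "\<dots> = (\<integral>v. (\<integral>\<omega>. h (U \<omega>) v \<partial>M) \<partial>distr M T V)"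
      by (intro Bochner_Integration.integral_cong refl integral_distr) auto
    finally show ?thesis .
  qed
  show ?thesis
    unfolding *[OF assms(2) int(1)] *[OF assms(3) int(2)]
    by (rule Bochner_Integration.integral_cong[OF refl]) (simp add: eq)
qed

text \<open>An event on the family \<open>I\<close> given by a product set is independent of
  \<open>Y i\<close> by hypothesis and factorises further by independence within \<open>I\<close>.
  This joins \<open>Z\<close> to the vectors \<open>X i\<close>.\<close>

lemma indep_vars_insert:
  assumes ind: "indep_pair M N (Y i) (PiM I (\<lambda>_. N)) (\<lambda>\<omega>. \<lambda>j\<in>I. Y j \<omega>)"
    and vars: "indep_vars (\<lambda>_. N) Y I" and I: "finite I" "I \<noteq> {}" "i \<notin> I"
  shows "indep_vars (\<lambda>_. N) Y (insert i I)"
proof -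
  have m: "Y j \<in> measurable M N" if "j \<in> insert i I" for j
    using that indep_pairD(1)[OF ind] vars by (auto simp: indep_vars_def)
  have sets: "sets N = sigma_sets (space N) (sets N)"
    using sets.sigma_sets_eq by metis
  show ?thesis
  proof (subst indep_vars_finite[where E="\<lambda>_. sets N"])
    show "\<forall>A\<in>insert i I \<rightarrow> sets N. prob (\<Inter>j\<in>insert i I. Y j -` A j \<inter> space M) = (\<Prod>j\<in>insert i I. prob (Y j -` A j \<inter> space M))"
    proof
      fix A assume A: "A \<in> insert i I \<rightarrow> sets N"
      let ?B = "\<Pi>\<^sub>E j\<in>I. A j"
      have B: "?B \<in> sets (PiM I (\<lambda>_. N))" using A I by (intro sets_PiM_I_finite) auto
      have eqB: "(\<lambda>\<omega>. \<lambda>j\<in>I. Y j \<omega>) -` ?B \<inter> space M = (\<Inter>j\<in>I. Y j -` A j \<inter> space M)"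
        using I by auto
      have "prob (\<Inter>j\<in>insert i I. Y j -` A j \<inter> space M) = prob ((Y i -` A i \<inter> space M) \<inter> (\<Inter>j\<in>I. Y j -` A j \<inter> space M))"
        by simp
      also have "\<dots> = prob (Y i -` A i \<inter> space M) * prob (\<Inter>j\<in>I. Y j -` A j \<inter> space M)"
        using indep_pairD(3)[OF ind _ B, of "A i"] A by (simp add: eqB)
      also have "prob (\<Inter>j\<in>I. Y j -` A j \<inter> space M) = (\<Prod>j\<in>I. prob (Y j -` A j \<inter> space M))"
        by (rule indep_varsD[OF vars I(2,1)]) (use A in auto)
      finally show "prob (\<Inter>j\<in>insert i I. Y j -` A j \<inter> space M) = (\<Prod>j\<in>insert i I. prob (Y j -` A j \<inter> space M))"
        using I by simp
    qed
  qed (use I m sets in \<open>auto simp: Int_stable_def sets.space_closed[THEN subsetD] dest: sets.sets_into_space\<close>)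
qed

text \<open>Isolates one summand of a weighted sum from the independent remainder, which is then
  frozen in the Stein identity.\<close>

lemma indep_vars_pair_weighted_sum:
  fixes Y :: "'i \<Rightarrow> 'a \<Rightarrow> 'b::euclidean_space"
  assumes "indep_vars (\<lambda>_. borel) Y I" "finite I" "i \<in> I"
  shows "indep_pair M borel (Y i) borel (\<lambda>\<omega>. \<Sum>j\<in>I-{i}. c j *\<^sub>R Y j \<omega>)"
proof -
  have "indep_pair M (PiM {i} (\<lambda>_. borel)) (\<lambda>\<omega>. \<lambda>j\<in>{i}. Y j \<omega>) (PiM (I-{i}) (\<lambda>_. borel)) (\<lambda>\<omega>. \<lambda>j\<in>I-{i}. Y j \<omega>)"
    unfolding indep_pair_iff_indep_var using assms by (intro indep_var_restrict[OF assms(1)]) auto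
  from indep_pair_compose[OF this, of "\<lambda>f. f i" borel "\<lambda>f. \<Sum>j\<in>I-{i}. c j *\<^sub>R f j" borel]
  show ?thesis by simp
qed

lemma indep_vars_pair:
  fixes Y :: "'i \<Rightarrow> 'a \<Rightarrow> 'b::euclidean_space"
  assumes "indep_vars (\<lambda>_. borel) Y I" "i \<in> I" "j \<in> I" "i \<noteq> j"
  shows "indep_pair M borel (Y i) borel (Y j)"
proof -
  have "indep_pair M (PiM {i} (\<lambda>_. borel)) (\<lambda>\<omega>. \<lambda>j\<in>{i}. Y j \<omega>) (PiM {j} (\<lambda>_. borel)) (\<lambda>\<omega>. \<lambda>j\<in>{j}. Y j \<omega>)"
    unfolding indep_pair_iff_indep_var using assms by (intro indep_var_restrict[OF assms(1)]) auto
  from indep_pair_compose[OF this, of "\<lambda>f. f i" borel "\<lambda>f. f j" borel]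
  show ?thesis by simp
qed

lemma indep_pair_mult:
  fixes f :: "'b \<Rightarrow> real" and g :: "'c \<Rightarrow> real"
  assumes "indep_pair M S U T V" "f \<in> borel_measurable S" "g \<in> borel_measurable T"
    "integrable M (\<lambda>\<omega>. f (U \<omega>))" "integrable M (\<lambda>\<omega>. g (V \<omega>))"
  shows "integrable M (\<lambda>\<omega>. f (U \<omega>) * g (V \<omega>))"
    "(\<integral>\<omega>. f (U \<omega>) * g (V \<omega>) \<partial>M) = (\<integral>\<omega>. f (U \<omega>) \<partial>M) * (\<integral>\<omega>. g (V \<omega>) \<partial>M)"
proof -
  have "indep_var borel (\<lambda>\<omega>. f (U \<omega>)) borel (\<lambda>\<omega>. g (V \<omega>))"
    using indep_pair_compose[OF assms(1-3)] by (simp only: indep_pair_iff_indep_var)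
  note indep_var_integrable[OF this assms(4,5)] indep_var_lebesgue_integral[OF this assms(4,5)]
  then show "integrable M (\<lambda>\<omega>. f (U \<omega>) * g (V \<omega>))"
    "(\<integral>\<omega>. f (U \<omega>) * g (V \<omega>) \<partial>M) = (\<integral>\<omega>. f (U \<omega>) \<partial>M) * (\<integral>\<omega>. g (V \<omega>) \<partial>M)"
    by simp_all
qed

text \<open>Conditionally on \<open>V\<close>, this is the defining identity of \<open>\<tau>\<close> for the test function
  \<open>x \<mapsto> \<phi> (c x + u(V))\<close>.\<close>

lemma stein_identity_independent:
  fixes X :: "'a \<Rightarrow> real^'d" and u :: "'c \<Rightarrow> real^'d" and w :: "'c \<Rightarrow> real"
  assumes stein: "is_stein_matrix M X \<tau>" and ind: "indep_pair M borel X T V" and \<phi>: "test_function \<phi>"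
    and u[measurable]: "u \<in> borel_measurable T" and w[measurable]: "w \<in> borel_measurable T"
    and int_\<tau>: "\<And>k. integrable M (\<lambda>\<omega>. \<tau> (X \<omega>) $ j $ k)" and int_X: "integrable M (\<lambda>\<omega>. X \<omega> $ j)"
    and int_w: "integrable M (\<lambda>\<omega>. w (V \<omega>))" and c: "c \<noteq> 0"
  shows "c * (\<integral>\<omega>. w (V \<omega>) * (\<Sum>k\<in>UNIV. \<tau> (X \<omega>) $ j $ k * partial_deriv k \<phi> (c *\<^sub>R X \<omega> + u (V \<omega>))) \<partial>M)
    = (\<integral>\<omega>. w (V \<omega>) * (\<phi> (c *\<^sub>R X \<omega> + u (V \<omega>)) * X \<omega> $ j) \<partial>M)"
proof -
  note [measurable] = indep_pairD(1,2)[OF ind]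
  have \<tau>[measurable]: "\<tau> \<in> borel_measurable borel" using stein by (simp add: is_stein_matrix_def)
  have [measurable]: "\<phi> \<in> borel_measurable borel" "partial_deriv k \<phi> \<in> borel_measurable borel" for k
    by (intro test_function_measurable test_function_partial_deriv \<phi>)+
  have "(\<integral>\<omega>. c * (w (V \<omega>) * (\<Sum>k\<in>UNIV. \<tau> (X \<omega>) $ j $ k * partial_deriv k \<phi> (c *\<^sub>R X \<omega> + u (V \<omega>)))) \<partial>M)
    = (\<integral>\<omega>. w (V \<omega>) * (\<phi> (c *\<^sub>R X \<omega> + u (V \<omega>)) * X \<omega> $ j) \<partial>M)"
  proof (rule indep_pair_integral_cong[OF ind, where f="\<lambda>x v. c * (w v * (\<Sum>k\<in>UNIV. \<tau> x $ j $ k * partial_deriv k \<phi> (c *\<^sub>R x + u v)))"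
        and g="\<lambda>x v. w v * (\<phi> (c *\<^sub>R x + u v) * x $ j)"])
    have "integrable M (\<lambda>\<omega>. partial_deriv k \<phi> (c *\<^sub>R X \<omega> + u (V \<omega>)) * (\<tau> (X \<omega>) $ j $ k * w (V \<omega>)))" for k
    proof -
      obtain B where B: "\<And>x. \<bar>partial_deriv k \<phi> x\<bar> \<le> B"
        using test_function_bounded[OF test_function_partial_deriv[OF \<phi>]] by metis
      show ?thesis
        by (rule integrable_bounded_mult[OF indep_pair_mult(1)[OF ind _ w int_\<tau> int_w] _ B]) auto
    qed
    then have "integrable M (\<lambda>\<omega>. \<Sum>k\<in>UNIV. c * (partial_deriv k \<phi> (c *\<^sub>R X \<omega> + u (V \<omega>)) * (\<tau> (X \<omega>) $ j $ k * w (V \<omega>))))"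
      by (intro Bochner_Integration.integrable_sum integrable_mult_right)
    then show "integrable M (\<lambda>\<omega>. c * (w (V \<omega>) * (\<Sum>k\<in>UNIV. \<tau> (X \<omega>) $ j $ k * partial_deriv k \<phi> (c *\<^sub>R X \<omega> + u (V \<omega>)))))"
      by (simp add: sum_distrib_left mult_ac)
    obtain B where B: "\<And>x. \<bar>\<phi> x\<bar> \<le> B"
      using test_function_bounded[OF \<phi>] by metis
    have "integrable M (\<lambda>\<omega>. \<phi> (c *\<^sub>R X \<omega> + u (V \<omega>)) * (X \<omega> $ j * w (V \<omega>)))"
      by (rule integrable_bounded_mult[OF indep_pair_mult(1)[OF ind _ w int_X int_w] _ B]) auto
    then show "integrable M (\<lambda>\<omega>. w (V \<omega>) * (\<phi> (c *\<^sub>R X \<omega> + u (V \<omega>)) * X \<omega> $ j))"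
      by (simp add: mult_ac)
    fix v
    \<comment> \<open>Here \<open>c \<noteq> 0\<close> keeps the support bounded. The chain rule
      turns each partial derivative of this function into \<open>c\<close> times one of
      \<open>\<phi>\<close>, the factor in front of the left-hand integral; \<open>w v\<close> is a
      constant.\<close>
    have t: "test_function (\<lambda>x. \<phi> (c *\<^sub>R x + u v))" by (rule test_function_affine[OF \<phi> c])
    have "(\<Sum>k\<in>UNIV. \<tau> x $ j $ k * partial_deriv k (\<lambda>x. \<phi> (c *\<^sub>R x + u v)) x)
        = c * (\<Sum>k\<in>UNIV. \<tau> x $ j $ k * partial_deriv k \<phi> (c *\<^sub>R x + u v))" for x
      by (simp add: partial_deriv_affine[OF test_function_differentiable[OF \<phi>]] sum_distrib_left mult_ac)
    with is_stein_matrixD(3)[OF stein t, of j]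
    have "(\<integral>\<omega>. c * (\<Sum>k\<in>UNIV. \<tau> (X \<omega>) $ j $ k * partial_deriv k \<phi> (c *\<^sub>R X \<omega> + u v)) \<partial>M)
        = (\<integral>\<omega>. \<phi> (c *\<^sub>R X \<omega> + u v) * X \<omega> $ j \<partial>M)" by simp
    then show "(\<integral>\<omega>. c * (w v * (\<Sum>k\<in>UNIV. \<tau> (X \<omega>) $ j $ k * partial_deriv k \<phi> (c *\<^sub>R X \<omega> + u v))) \<partial>M)
        = (\<integral>\<omega>. w v * (\<phi> (c *\<^sub>R X \<omega> + u v) * X \<omega> $ j) \<partial>M)"
      by (simp add: mult.left_commute[of c])
  qed measurable
  then show ?thesis by simp
qed

end

subsection \<open>The smoothed sum\<close>

lemma integral_sum_mult_sum:
  fixes U W :: "'i \<Rightarrow> 'a \<Rightarrow> real"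
  assumes "finite I" and int: "\<And>i j. i \<in> I \<Longrightarrow> j \<in> I \<Longrightarrow> integrable M (\<lambda>\<omega>. U i \<omega> * W j \<omega>)"
    and orth: "\<And>i j. i \<in> I \<Longrightarrow> j \<in> I \<Longrightarrow> i \<noteq> j \<Longrightarrow> (\<integral>\<omega>. U i \<omega> * W j \<omega> \<partial>M) = 0"
  shows "integrable M (\<lambda>\<omega>. (\<Sum>i\<in>I. U i \<omega>) * (\<Sum>i\<in>I. W i \<omega>))"
    and "(\<integral>\<omega>. (\<Sum>i\<in>I. U i \<omega>) * (\<Sum>i\<in>I. W i \<omega>) \<partial>M) = (\<Sum>i\<in>I. \<integral>\<omega>. U i \<omega> * W i \<omega> \<partial>M)"
proof -
  show "integrable M (\<lambda>\<omega>. (\<Sum>i\<in>I. U i \<omega>) * (\<Sum>i\<in>I. W i \<omega>))"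
    unfolding sum_product by (intro Bochner_Integration.integrable_sum int)
  have "(\<integral>\<omega>. (\<Sum>i\<in>I. U i \<omega>) * (\<Sum>i\<in>I. W i \<omega>) \<partial>M) = (\<Sum>i\<in>I. \<Sum>j\<in>I. \<integral>\<omega>. U i \<omega> * W j \<omega> \<partial>M)"
    unfolding sum_product using int by (simp add: Bochner_Integration.integral_sum)
  also have "\<dots> = (\<Sum>i\<in>I. \<Sum>j\<in>I. if j = i then \<integral>\<omega>. U i \<omega> * W j \<omega> \<partial>M else 0)"
    by (intro sum.cong refl) (auto simp: orth)
  also have "\<dots> = (\<Sum>i\<in>I. \<integral>\<omega>. U i \<omega> * W i \<omega> \<partial>M)"
    using \<open>finite I\<close> by simp
  finally show "(\<integral>\<omega>. (\<Sum>i\<in>I. U i \<omega>) * (\<Sum>i\<in>I. W i \<omega>) \<partial>M) = (\<Sum>i\<in>I. \<integral>\<omega>. U i \<omega> * W i \<omega> \<partial>M)" .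
qed

lemma outer_product_nth: "outer_product v $ i $ j = v $ i * v $ j"
  by (simp add: outer_product_def matrix_matrix_mult_def columnvector_def rowvector_def)

lemma integral_outer_product:
  fixes V :: "'a \<Rightarrow> real^'d"
  assumes "\<And>k l. integrable M (\<lambda>\<omega>. V \<omega> $ k * V \<omega> $ l)"
  shows "integrable M (\<lambda>\<omega>. outer_product (V \<omega>))"
    and "(\<integral>\<omega>. outer_product (V \<omega>) \<partial>M) $ k $ l = (\<integral>\<omega>. V \<omega> $ k * V \<omega> $ l \<partial>M)"
proof -
  show *: "integrable M (\<lambda>\<omega>. outer_product (V \<omega>))"
    by (intro integrable_vec_componentwise) (simp add: outer_product_nth assms)
  show "(\<integral>\<omega>. outer_product (V \<omega>) \<partial>M) $ k $ l = (\<integral>\<omega>. V \<omega> $ k * V \<omega> $ l \<partial>M)"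
    unfolding integrable_vec_nth(2)[OF *, symmetric] integrable_vec_nth(2)[OF integrable_vec_nth(1)[OF *], symmetric]
    by (simp add: outer_product_nth)
qed

lemma integrable_square_add:
  fixes f g :: "'a \<Rightarrow> real"
  assumes "integrable M (\<lambda>x. (f x)\<^sup>2)" "integrable M (\<lambda>x. (g x)\<^sup>2)"
    "f \<in> borel_measurable M" "g \<in> borel_measurable M"
  shows "integrable M (\<lambda>x. (f x + g x)\<^sup>2)"
proof -
  have "integrable M (\<lambda>x. (f x)\<^sup>2 + (g x)\<^sup>2 + 2 * (f x * g x))"
    using assms integrable_mult_of_squares[OF assms] by simp
  then show ?thesis by (simp add: power2_sum mult.assoc)
qed

text \<open>The integrand is odd and Lebesgue measure is invariant under reflection.\<close>

lemma std_gaussian_mean_0: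
  fixes Z :: "'a \<Rightarrow> real^'d"
  assumes D: "distributed M lborel Z (\<lambda>x. ennreal (std_gaussian_density x))"
  shows "(\<integral>\<omega>. Z \<omega> $ k \<partial>M) = 0"
proof -
  let ?f = "\<lambda>x::real^'d. std_gaussian_density x * x $ k"
  have [measurable]: "?f \<in> borel_measurable borel"
    by (intro borel_measurable_continuous_onI C_k_imp_continuous[of 0] C_k_mult C_k_std_gaussian_density C_k_coord smooth_real_id)
  have reflect: "lborel = distr lborel borel (\<lambda>x::real^'d. - x)"
    using lborel_affine[of "-1" "0 :: real^'d"] by (simp add: density_1)
  have "(\<integral>x. ?f x \<partial>lborel) = (\<integral>x. ?f x \<partial>distr lborel borel (\<lambda>x::real^'d. - x))"
    by (rule arg_cong[OF reflect])
  also have "\<dots> = (\<integral>x. - ?f x \<partial>lborel)"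
    by (subst integral_distr) (auto simp: std_gaussian_density_eq)
  finally have "(\<integral>x. ?f x \<partial>lborel) = 0" by simp
  then show ?thesis
    using distributed_integral[OF D _ std_gaussian_density_nonneg, of "\<lambda>x. x $ k"] by simp
qed

lemma matrix_inv_mat_1: "matrix_inv (mat 1 :: real^'d^'d) = mat 1"
  unfolding matrix_inv_def by (rule some_equality) auto

text \<open>The trace of \<open>A A^T\<close> is the squared Hilbert-Schmidt norm of
  \<open>A\<close>.\<close>

lemma trace_expectation_sq_eq:
  assumes [measurable]: "\<And>j k. (\<lambda>\<omega>. A \<omega> $ j $ k) \<in> borel_measurable M"
  shows "trace_expectation_sq M A = (\<Sum>j\<in>UNIV. \<Sum>k\<in>UNIV. \<integral>\<^sup>+\<omega>. ennreal ((A \<omega> $ j $ k)\<^sup>2) \<partial>M)"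
proof -
  have "(A \<omega> ** transpose (A \<omega>)) $ j $ j = (\<Sum>k\<in>UNIV. (A \<omega> $ j $ k)\<^sup>2)" for \<omega> j
    by (simp add: matrix_matrix_mult_def transpose_def power2_eq_square)
  then show ?thesis
    by (simp add: trace_expectation_sq_def nn_integral_sum flip: sum_ennreal)
qed

section \<open>Moments of the smoothed sum\<close>

locale gaussian_smoothed_sum = prob_space M for M :: "'a measure" +
  fixes n :: nat and X :: "nat \<Rightarrow> 'a \<Rightarrow> real^'d" and Z :: "'a \<Rightarrow> real^'d"
    and \<tau> :: "nat \<Rightarrow> real^'d \<Rightarrow> real^'d^'d" and t :: real
  assumes n: "n \<ge> 1"
    and indep_X: "indep_vars (\<lambda>_. borel) X {1..n}"
    and sq_X: "\<And>i. i \<in> {1..n} \<Longrightarrow> integrable M (\<lambda>\<omega>. (norm (X i \<omega>))\<^sup>2)"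
    and mean_X: "\<And>i. i \<in> {1..n} \<Longrightarrow> (LINT \<omega>|M. X i \<omega>) = 0"
    and cov_X: "\<And>i. i \<in> {1..n} \<Longrightarrow> covariance_matrix M (X i) = mat 1"
    and stein_X: "\<And>i. i \<in> {1..n} \<Longrightarrow> is_stein_matrix M (X i) (\<tau> i)"
    and gauss_Z: "distributed M lborel Z (\<lambda>x. ennreal (std_gaussian_density x))"
    and indep_Z: "indep_pair M borel Z (PiM {1..n} (\<lambda>_. borel)) (\<lambda>\<omega>. \<lambda>i\<in>{1..n}. X i \<omega>)"
    and t: "0 \<le> t" "t < 1"
begin

definition "V = gaussian_interpolation t (normalized_sum n X) Z"
definition "s = sqrt (1 - t)"
definition "a = sqrt t / sqrt (real n)"
text \<open>The Gaussian becomes the summand of index 0, so that \<open>V\<close> is one weighted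
  sum of the independent vectors \<open>Y 0, ..., Y n\<close> and any single summand can be split
  off uniformly.\<close>

definition "Y i = (if i = 0 then Z else X i)"
definition "c i = (if i = 0 then s else a)" for i :: nat

lemma s_pos: "s > 0" and s_sq: "s\<^sup>2 = 1 - t"
  using t by (simp_all add: s_def)

lemma a_sq: "a\<^sup>2 = t / real n"
  using t by (simp add: a_def power_divide)

lemma measurable_Z [measurable]: "Z \<in> borel_measurable M"
  using indep_pairD(1)[OF indep_Z] .

lemma measurable_X [measurable]: "i \<in> {1..n} \<Longrightarrow> X i \<in> borel_measurable M"
  using indep_X by (auto simp: indep_vars_def)

lemma measurable_Y [measurable]: "i \<in> {0..n} \<Longrightarrow> Y i \<in> borel_measurable M"
  by (auto simp: Y_def)

lemma V_eq_Z: "V \<omega> = s *\<^sub>R Z \<omega> + a *\<^sub>R (\<Sum>i=1..n. X i \<omega>)"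
  by (simp add: V_def gaussian_interpolation_def normalized_sum_def s_def a_def)

lemma V_eq: "V \<omega> = (\<Sum>i\<in>{0..n}. c i *\<^sub>R Y i \<omega>)"
  by (simp add: V_eq_Z sum.atLeast_Suc_atMost[of 0] c_def Y_def scaleR_sum_right)

lemma V_eq_X:
  assumes "i \<in> {1..n}"
  shows "V \<omega> = a *\<^sub>R X i \<omega> + (\<Sum>j\<in>{0..n}-{i}. c j *\<^sub>R Y j \<omega>)"
  unfolding V_eq using assms by (subst sum.remove[of _ i]) (auto simp: c_def Y_def)

lemma measurable_V [measurable]: "V \<in> borel_measurable M"
  unfolding V_eq[abs_def] by measurable

lemma indep_Y: "indep_vars (\<lambda>_. borel) Y {0..n}"
proof -
  have "indep_vars (\<lambda>_. borel) Y (insert 0 {1..n})"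
  proof (rule indep_vars_insert)
    have "(\<lambda>\<omega>. \<lambda>j\<in>{1..n}. Y j \<omega>) = (\<lambda>\<omega>. \<lambda>j\<in>{1..n}. X j \<omega>)"
      by (intro ext) (auto simp: Y_def)
    then show "indep_pair M borel (Y 0) (PiM {1..n} (\<lambda>_. borel)) (\<lambda>\<omega>. \<lambda>j\<in>{1..n}. Y j \<omega>)"
      using indep_Z by (simp add: Y_def[abs_def])
    show "indep_vars (\<lambda>_. borel) Y {1..n}"
      using indep_X by (subst indep_vars_cong[where Y=X]) (auto simp: Y_def)
  qed (use n in auto)
  moreover have "insert 0 {1..n} = {0..n}" by auto
  ultimately show ?thesis by simp
qed

text \<open>For \<open>i = 0\<close> the second moments come from the Stein matrix \<open>Id\<close>
  of \<open>Z\<close>, without computing Gaussian integrals; for the other indices they are the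
  covariance hypothesis, the means being 0.\<close>

lemma Y_moments:
  assumes "i \<in> {0..n}"
  shows "integrable M (\<lambda>\<omega>. Y i \<omega> $ k * Y i \<omega> $ l)"
    and "(\<integral>\<omega>. Y i \<omega> $ k * Y i \<omega> $ l \<partial>M) = (if k = l then 1 else 0)"
    and "integrable M (\<lambda>\<omega>. Y i \<omega> $ k)"
    and "(\<integral>\<omega>. Y i \<omega> $ k \<partial>M) = 0"
proof -
  note [measurable] = measurable_Y[OF assms]
  show int: "integrable M (\<lambda>\<omega>. Y i \<omega> $ k * Y i \<omega> $ l)" for k l
  proof (cases "i = 0")
    case True
    then show ?thesis
      using stein_matrix_second_moment(1)[OF _ std_gaussian_is_stein_matrix[OF gauss_Z]] by (simp add: Y_def)
  next
    case False
    then have i: "i \<in> {1..n}" "Y i = X i" using assms by (auto simp: Y_def)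
    have "integrable M (\<lambda>\<omega>. (Y i \<omega> $ k)\<^sup>2)" for k
    proof (rule Bochner_Integration.integrable_bound[OF sq_X[OF i(1)]])
      have "(Y i \<omega> $ k)\<^sup>2 \<le> (norm (X i \<omega>))\<^sup>2" for \<omega>
        unfolding i(2) using component_le_norm_cart[of "X i \<omega>" k] abs_le_square_iff by fastforce
      then show "AE \<omega> in M. norm ((Y i \<omega> $ k)\<^sup>2) \<le> norm ((norm (X i \<omega>))\<^sup>2)" by simp
    qed measurable
    then show ?thesis by (intro integrable_mult_of_squares) auto
  qed
  show int1: "integrable M (\<lambda>\<omega>. Y i \<omega> $ k)" for k
    by (rule square_integrable_imp_integrable) (measurable, simp add: power2_eq_square int)
  show "(\<integral>\<omega>. Y i \<omega> $ k \<partial>M) = 0"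
  proof (cases "i = 0")
    case True
    then show ?thesis using std_gaussian_mean_0[OF gauss_Z] by (simp add: Y_def)
  next
    case False
    then have i: "i \<in> {1..n}" "Y i = X i" using assms by (auto simp: Y_def)
    have "integrable M (Y i)" using int1 by (rule integrable_vec_componentwise)
    from integrable_vec_nth(2)[OF this, of k] show ?thesis using mean_X[OF i(1)] by (simp add: i(2))
  qed
  show "(\<integral>\<omega>. Y i \<omega> $ k * Y i \<omega> $ l \<partial>M) = (if k = l then 1 else 0)"
  proof (cases "i = 0")
    case True
    have "(\<integral>\<omega>. Z \<omega> $ k * Z \<omega> $ l \<partial>M) = (\<integral>\<omega>. mat 1 $ k $ l \<partial>M)"
      by (rule stein_matrix_second_moment(2)[OF _ std_gaussian_is_stein_matrix[OF gauss_Z]]) auto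
    then show ?thesis using True by (simp add: Y_def mat_def prob_space)
  next
    case False
    then have i: "i \<in> {1..n}" "Y i = X i" using assms by (auto simp: Y_def)
    have "(\<integral>\<omega>. Y i \<omega> $ k * Y i \<omega> $ l \<partial>M) = covariance_matrix M (X i) $ k $ l"
      using integral_outer_product(2)[OF int, of k l] by (simp add: covariance_matrix_def mean_X[OF i(1)] i(2))
    then show ?thesis using cov_X[OF i(1)] by (simp add: mat_def)
  qed
qed

lemma V_moments:
  shows "integrable M (\<lambda>\<omega>. V \<omega> $ k * V \<omega> $ l)"
    and "(\<integral>\<omega>. V \<omega> $ k * V \<omega> $ l \<partial>M) = (if k = l then 1 else 0)"
    and "(\<integral>\<omega>. V \<omega> \<partial>M) = 0" "integrable M (\<lambda>\<omega>. V \<omega> $ k)"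
proof -
  have prod: "integrable M (\<lambda>\<omega>. (c i * Y i \<omega> $ k) * (c j * Y j \<omega> $ l)) \<and>
    (\<integral>\<omega>. (c i * Y i \<omega> $ k) * (c j * Y j \<omega> $ l) \<partial>M) = (if i = j \<and> k = l then (c i)\<^sup>2 else 0)"
    if ij: "i \<in> {0..n}" "j \<in> {0..n}" for i j k l
  proof -
    have eq: "(c i * Y i \<omega> $ k) * (c j * Y j \<omega> $ l) = (c i * c j) * (Y i \<omega> $ k * Y j \<omega> $ l)" for \<omega> by simp
    have "integrable M (\<lambda>\<omega>. Y i \<omega> $ k * Y j \<omega> $ l) \<and> (\<integral>\<omega>. Y i \<omega> $ k * Y j \<omega> $ l \<partial>M) = (if i = j \<and> k = l then 1 else 0)"
    proof (cases "i = j")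
      case True
      then show ?thesis using Y_moments[OF ij(1)] by simp
    next
      case False
      note ind = indep_vars_pair[OF indep_Y ij False]
      show ?thesis
        using indep_pair_mult[OF ind, of "\<lambda>x. x $ k" "\<lambda>x. x $ l"] Y_moments(3,4)[OF ij(1)] Y_moments(3,4)[OF ij(2)] False
        by simp
    qed
    then show ?thesis unfolding eq by (auto simp: power2_eq_square)
  qed
  have V_nth: "V \<omega> $ k = (\<Sum>i\<in>{0..n}. c i * Y i \<omega> $ k)" for \<omega> k by (simp add: V_eq)
  show "integrable M (\<lambda>\<omega>. V \<omega> $ k * V \<omega> $ l)"
    unfolding V_nth using prod by (intro integral_sum_mult_sum(1)) auto
  have "(\<integral>\<omega>. V \<omega> $ k * V \<omega> $ l \<partial>M) = (\<Sum>i\<in>{0..n}. if k = l then (c i)\<^sup>2 else 0)"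
    unfolding V_nth using prod by (subst integral_sum_mult_sum(2)) auto
  \<comment> \<open>This is \<open>s^2 + n a^2 = (1 - t) + t\<close>: the interpolation preserves
    the identity covariance.\<close>
  moreover have "(\<Sum>i\<in>{0..n}. (c i)\<^sup>2) = 1"
    using n by (simp add: sum.atLeast_Suc_atMost[of 0] c_def s_sq a_sq)
  ultimately show "(\<integral>\<omega>. V \<omega> $ k * V \<omega> $ l \<partial>M) = (if k = l then 1 else 0)" by simp
  show int: "integrable M (\<lambda>\<omega>. V \<omega> $ k)" for k
    unfolding V_nth using Y_moments(3) by (intro Bochner_Integration.integrable_sum integrable_mult_right) auto
  have "(\<integral>\<omega>. V \<omega> $ k \<partial>M) = 0" for k
    unfolding V_nth using Y_moments(3,4) by (subst Bochner_Integration.integral_sum) auto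
  then show "(\<integral>\<omega>. V \<omega> \<partial>M) = 0"
    using integrable_vec_nth(2)[OF integrable_vec_componentwise[OF int]] by (simp add: vec_eq_iff)
qed

lemma covariance_V: "covariance_matrix M V = mat 1"
  using integral_outer_product(2)[OF V_moments(1)]
  by (simp add: covariance_matrix_def V_moments(2,3) vec_eq_iff mat_def)

lemma fisher_integrand_V: "fisher_integrand M V \<rho> = (\<lambda>\<omega>. outer_product (\<rho> (V \<omega>) + V \<omega>))"
  by (simp add: fisher_integrand_def covariance_V matrix_inv_mat_1 fun_eq_iff)

lemma J_st_V:
  assumes "\<rho> \<in> borel_measurable borel" and sq: "\<And>j. integrable M (\<lambda>\<omega>. (\<rho> (V \<omega>) $ j + V \<omega> $ j)\<^sup>2)"
  shows "integrable M (fisher_integrand M V \<rho>)"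
    and "J_st M V \<rho> = (\<Sum>j\<in>UNIV. \<integral>\<omega>. (\<rho> (V \<omega>) $ j + V \<omega> $ j)\<^sup>2 \<partial>M)"
proof -
  note [measurable] = assms(1)
  have int: "integrable M (\<lambda>\<omega>. (\<rho> (V \<omega>) + V \<omega>) $ k * (\<rho> (V \<omega>) + V \<omega>) $ l)" for k l
    using sq by (intro integrable_mult_of_squares) auto
  show "integrable M (fisher_integrand M V \<rho>)"
    unfolding fisher_integrand_V by (rule integral_outer_product(1)[OF int])
  show "J_st M V \<rho> = (\<Sum>j\<in>UNIV. \<integral>\<omega>. (\<rho> (V \<omega>) $ j + V \<omega> $ j)\<^sup>2 \<partial>M)"
    by (simp add: J_st_def covariance_V J_matrix_def fisher_integrand_V trace_def
      integral_outer_product(2)[OF int] power2_eq_square)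
qed

section \<open>Integration by parts in the Gaussian and the score of the smoothed sum\<close>

lemma gaussian_weighted_integration_by_parts:
  assumes \<phi>: "test_function \<phi>" and w: "w \<in> borel_measurable (PiM {1..n} (\<lambda>_. borel))"
    and int_w: "integrable M (\<lambda>\<omega>. w (\<lambda>i\<in>{1..n}. X i \<omega>))"
  shows "s * (\<integral>\<omega>. w (\<lambda>i\<in>{1..n}. X i \<omega>) * partial_deriv j \<phi> (V \<omega>) \<partial>M)
    = (\<integral>\<omega>. w (\<lambda>i\<in>{1..n}. X i \<omega>) * (\<phi> (V \<omega>) * Z \<omega> $ j) \<partial>M)"
proof -
  have u: "(\<lambda>x. a *\<^sub>R (\<Sum>i=1..n. x i)) \<in> borel_measurable (PiM {1..n} (\<lambda>_. borel :: (real^'d) measure))"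
    by measurable
  have "s * (\<integral>\<omega>. w (\<lambda>i\<in>{1..n}. X i \<omega>) * (\<Sum>k\<in>UNIV. mat 1 $ j $ k * partial_deriv k \<phi> (s *\<^sub>R Z \<omega> + a *\<^sub>R (\<Sum>i=1..n. (\<lambda>i\<in>{1..n}. X i \<omega>) i))) \<partial>M)
    = (\<integral>\<omega>. w (\<lambda>i\<in>{1..n}. X i \<omega>) * (\<phi> (s *\<^sub>R Z \<omega> + a *\<^sub>R (\<Sum>i=1..n. (\<lambda>i\<in>{1..n}. X i \<omega>) i)) * Z \<omega> $ j) \<partial>M)"
    by (rule stein_identity_independent[OF std_gaussian_is_stein_matrix[OF gauss_Z] indep_Z \<phi> u w])
      (use s_pos Y_moments(3)[of 0 j] int_w in \<open>simp_all add: Y_def\<close>)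
  moreover have "(\<Sum>k\<in>UNIV. mat 1 $ j $ k * g k) = g j" for g :: "'d \<Rightarrow> real"
    by (simp add: mat_def if_distrib[of "\<lambda>x. x * _"] cong: if_cong)
  ultimately show ?thesis by (simp add: V_eq_Z)
qed

lemma gaussian_integration_by_parts:
  assumes "test_function \<phi>"
  shows "s * (\<integral>\<omega>. partial_deriv j \<phi> (V \<omega>) \<partial>M) = (\<integral>\<omega>. \<phi> (V \<omega>) * Z \<omega> $ j \<partial>M)"
proof -
  have "s * (\<integral>\<omega>. 1 * partial_deriv j \<phi> (V \<omega>) \<partial>M) = (\<integral>\<omega>. 1 * (\<phi> (V \<omega>) * Z \<omega> $ j) \<partial>M)"
    by (rule gaussian_weighted_integration_by_parts[OF assms]) auto
  then show ?thesis by simp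
qed

lemma integrable_test_function_V:
  assumes \<phi>: "test_function \<phi>" and "integrable M h"
  shows "integrable M (\<lambda>\<omega>. \<phi> (V \<omega>) * h \<omega>)"
proof -
  note [measurable] = test_function_measurable[OF \<phi>]
  obtain B where B: "\<And>x. \<bar>\<phi> x\<bar> \<le> B" using test_function_bounded[OF \<phi>] by metis
  show ?thesis by (rule integrable_bounded_mult[OF assms(2) _ B]) auto
qed

text \<open>Integration by parts in \<open>Z\<close> shows that \<open>- E[Z | V] / s\<close> is a
  score; the Gaussian component alone provides it, as \<open>s > 0\<close>.\<close>

lemma score_exists: "\<exists>\<rho>. is_score M V \<rho>"
proof -
  have Z: "integrable M (\<lambda>\<omega>. Z \<omega> $ j)" for j using Y_moments(3)[of 0] by (simp add: Y_def)
  have "\<exists>g. g \<in> borel_measurable borel \<and> integrable M (\<lambda>\<omega>. g (V \<omega>)) \<and>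
    (\<forall>\<phi>. test_function \<phi> \<longrightarrow> (\<integral>\<omega>. \<phi> (V \<omega>) * Z \<omega> $ j \<partial>M) = (\<integral>\<omega>. \<phi> (V \<omega>) * g (V \<omega>) \<partial>M))" for j
  proof -
    obtain g where g: "g \<in> borel_measurable borel" "integrable M (\<lambda>x. g (V x))"
      "\<And>\<phi> B. \<phi> \<in> borel_measurable borel \<Longrightarrow> (\<And>x. \<bar>\<phi> x\<bar> \<le> B) \<Longrightarrow> (\<integral>\<omega>. \<phi> (V \<omega>) * Z \<omega> $ j \<partial>M) = (\<integral>\<omega>. \<phi> (V \<omega>) * g (V \<omega>) \<partial>M)"
      using conditional_expectation[OF measurable_V Z[of j]] by blast
    have "(\<integral>\<omega>. \<phi> (V \<omega>) * Z \<omega> $ j \<partial>M) = (\<integral>\<omega>. \<phi> (V \<omega>) * g (V \<omega>) \<partial>M)" if \<phi>: "test_function \<phi>" for \<phi>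
    proof -
      obtain B where B: "\<And>x. \<bar>\<phi> x\<bar> \<le> B" using test_function_bounded[OF \<phi>] by metis
      show ?thesis by (rule g(3)[OF test_function_measurable[OF \<phi>] B])
    qed
    then show ?thesis using g by blast
  qed
  then have "\<exists>g. \<forall>j. g j \<in> borel_measurable borel \<and> integrable M (\<lambda>\<omega>. g j (V \<omega>)) \<and>
    (\<forall>\<phi>. test_function \<phi> \<longrightarrow> (\<integral>\<omega>. \<phi> (V \<omega>) * Z \<omega> $ j \<partial>M) = (\<integral>\<omega>. \<phi> (V \<omega>) * g j (V \<omega>) \<partial>M))"
    by (intro choice allI)
  then obtain g where g: "\<And>j. g j \<in> borel_measurable borel" "\<And>j. integrable M (\<lambda>\<omega>. g j (V \<omega>))"
    "\<And>j \<phi>. test_function \<phi> \<Longrightarrow> (\<integral>\<omega>. \<phi> (V \<omega>) * Z \<omega> $ j \<partial>M) = (\<integral>\<omega>. \<phi> (V \<omega>) * g j (V \<omega>) \<partial>M)"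
    by blast
  have "is_score M V (\<lambda>x. \<chi> j. - (1 / s) * g j x)"
    unfolding is_score_def
  proof (intro conjI allI impI)
    have "(\<lambda>x. \<Sum>j\<in>UNIV. (- (1 / s) * g j x) *\<^sub>R axis j (1::real)) \<in> borel_measurable borel"
      using g(1) by measurable
    moreover have "(\<Sum>j\<in>UNIV. (f j) *\<^sub>R axis j (1::real)) = (\<chi> j. f j)" for f :: "'d \<Rightarrow> real"
      by (simp add: vec_eq_iff axis_def if_distrib cong: if_cong)
    ultimately show "(\<lambda>x. \<chi> j. - (1 / s) * g j x) \<in> borel_measurable borel" by (simp only:)
    fix \<phi> :: "real^'d \<Rightarrow> real" assume \<phi>: "test_function \<phi>"
    have i: "integrable M (\<lambda>\<omega>. \<phi> (V \<omega>) * g j (V \<omega>))" for j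
      by (rule integrable_test_function_V[OF \<phi> g(2)])
    show i1: "integrable M (\<lambda>\<omega>. \<phi> (V \<omega>) *\<^sub>R (\<chi> j. - (1 / s) * g j (V \<omega>)))"
      using i by (intro integrable_vec_componentwise) (simp add: mult.left_commute)
    have "integrable M (\<lambda>\<omega>. partial_deriv j \<phi> (V \<omega>))" for j
      using integrable_test_function_V[OF test_function_partial_deriv[OF \<phi>], of "\<lambda>_. 1"] by simp
    then show i2: "integrable M (\<lambda>\<omega>. gradient \<phi> (V \<omega>))"
      by (intro integrable_vec_componentwise) (simp add: gradient_def)
    have "(\<integral>\<omega>. - (1 / s) * (\<phi> (V \<omega>) * g j (V \<omega>)) \<partial>M) = - (\<integral>\<omega>. partial_deriv j \<phi> (V \<omega>) \<partial>M)" for j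
      using g(3)[OF \<phi>, of j] gaussian_integration_by_parts[OF \<phi>, of j] s_pos by (simp add: field_simps)
    then show "(\<integral>\<omega>. \<phi> (V \<omega>) *\<^sub>R (\<chi> j. - (1 / s) * g j (V \<omega>)) \<partial>M) = - (\<integral>\<omega>. gradient \<phi> (V \<omega>) \<partial>M)"
      unfolding vec_eq_iff uminus_vec_def vec_lambda_beta
        integrable_vec_nth(2)[OF i1, symmetric] integrable_vec_nth(2)[OF i2, symmetric]
      by (simp add: gradient_def mult.left_commute[of "\<phi> _"])
  qed
  then show ?thesis by blast
qed

lemma integrable_Z: "integrable M (\<lambda>\<omega>. Z \<omega> $ j)"
  using Y_moments(3)[of 0] by (simp add: Y_def)

lemma integrable_X: "i \<in> {1..n} \<Longrightarrow> integrable M (\<lambda>\<omega>. X i \<omega> $ j)"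
  using Y_moments(3)[of i] by (auto simp: Y_def)

lemma Z_second_moments:
  "integrable M (\<lambda>\<omega>. Z \<omega> $ k * Z \<omega> $ l)" "(\<integral>\<omega>. Z \<omega> $ k * Z \<omega> $ l \<partial>M) = (if k = l then 1 else 0)"
  using Y_moments(1,2)[of 0] by (simp_all add: Y_def)

text \<open>Expanding \<open>V\<close>, the Gaussian term \<open>s E[\<phi>(V) Z]\<close> equals
  \<open>(1 - t) E[grad \<phi>(V)]\<close> and cancels all but the fraction \<open>t\<close> of the
  gradient term produced by the score.\<close>

lemma integral_test_function_score_plus_V:
  assumes "is_score M V \<rho>" and \<phi>: "test_function \<phi>"
  shows "integrable M (\<lambda>\<omega>. \<phi> (V \<omega>) * (\<rho> (V \<omega>) $ j + V \<omega> $ j))"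
    and "(\<integral>\<omega>. \<phi> (V \<omega>) * (\<rho> (V \<omega>) $ j + V \<omega> $ j) \<partial>M)
      = a * (\<Sum>i=1..n. \<integral>\<omega>. \<phi> (V \<omega>) * X i \<omega> $ j \<partial>M) - t * (\<integral>\<omega>. partial_deriv j \<phi> (V \<omega>) \<partial>M)"
proof -
  note iV = integrable_test_function_V[OF \<phi> V_moments(4)[of j]]
    and iX = integrable_test_function_V[OF \<phi> integrable_X]
    and iZ = integrable_test_function_V[OF \<phi> integrable_Z]
  note sc = is_scoreD[OF assms, of j]
  show "integrable M (\<lambda>\<omega>. \<phi> (V \<omega>) * (\<rho> (V \<omega>) $ j + V \<omega> $ j))"
    using sc(1) iV by (simp add: distrib_left)
  have V_nth: "V \<omega> $ j = s * Z \<omega> $ j + a * (\<Sum>i=1..n. X i \<omega> $ j)" for \<omega>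
    by (simp add: V_eq_Z)
  have "(\<integral>\<omega>. \<phi> (V \<omega>) * V \<omega> $ j \<partial>M)
      = (\<integral>\<omega>. s * (\<phi> (V \<omega>) * Z \<omega> $ j) + a * (\<Sum>i=1..n. \<phi> (V \<omega>) * X i \<omega> $ j) \<partial>M)"
    by (rule Bochner_Integration.integral_cong[OF refl])
      (simp add: V_nth distrib_left sum_distrib_left mult_ac)
  also have "\<dots> = s * (\<integral>\<omega>. \<phi> (V \<omega>) * Z \<omega> $ j \<partial>M) + a * (\<integral>\<omega>. (\<Sum>i=1..n. \<phi> (V \<omega>) * X i \<omega> $ j) \<partial>M)"
    using iZ Bochner_Integration.integrable_sum[OF iX, where I="{1..n}"] by simp
  also have "(\<integral>\<omega>. (\<Sum>i=1..n. \<phi> (V \<omega>) * X i \<omega> $ j) \<partial>M) = (\<Sum>i=1..n. \<integral>\<omega>. \<phi> (V \<omega>) * X i \<omega> $ j \<partial>M)"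
    by (rule Bochner_Integration.integral_sum) (rule iX)
  also have "s * (\<integral>\<omega>. \<phi> (V \<omega>) * Z \<omega> $ j \<partial>M) = (1 - t) * (\<integral>\<omega>. partial_deriv j \<phi> (V \<omega>) \<partial>M)"
    unfolding gaussian_integration_by_parts[OF \<phi>, symmetric] by (simp flip: s_sq add: power2_eq_square)
  finally show "(\<integral>\<omega>. \<phi> (V \<omega>) * (\<rho> (V \<omega>) $ j + V \<omega> $ j) \<partial>M)
      = a * (\<Sum>i=1..n. \<integral>\<omega>. \<phi> (V \<omega>) * X i \<omega> $ j \<partial>M) - t * (\<integral>\<omega>. partial_deriv j \<phi> (V \<omega>) \<partial>M)"
    using sc iV by (simp add: distrib_left left_diff_distrib)
qed

text \<open>Comparison with \<open>h = - Z $ j / s + V $ j\<close>, square integrable with no moment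
  condition on the Stein matrices. It makes \<open>J_st\<close> a genuine expectation even when the
  bound to be proved is infinite.\<close>

lemma score_plus_V_square_integrable:
  assumes score: "is_score M V \<rho>"
  shows "integrable M (\<lambda>\<omega>. (\<rho> (V \<omega>) $ j + V \<omega> $ j)\<^sup>2)"
proof -
  have [measurable]: "\<rho> \<in> borel_measurable borel" using score by (simp add: is_score_def)
  define h where "h \<omega> = - (1 / s) * Z \<omega> $ j + V \<omega> $ j" for \<omega>
  have "integrable M (\<lambda>\<omega>. (- (1 / s) * Z \<omega> $ j)\<^sup>2)" "integrable M (\<lambda>\<omega>. (V \<omega> $ j)\<^sup>2)"
    using Z_second_moments(1)[of j j] V_moments(1)[of j j] by (auto simp: power2_eq_square power_mult_distrib)
  then have h2: "integrable M (\<lambda>\<omega>. (h \<omega>)\<^sup>2)"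
    unfolding h_def by (rule integrable_square_add) auto
  show ?thesis
  proof (rule square_integral_le_of_test_identity(1)[OF measurable_V _ _ h2, where g="\<lambda>x. \<rho> x $ j + x $ j"])
    fix \<phi> :: "real^'d \<Rightarrow> real" assume \<phi>: "test_function \<phi>"
    show "integrable M (\<lambda>\<omega>. \<phi> (V \<omega>) * (\<rho> (V \<omega>) $ j + V \<omega> $ j))"
      by (rule integral_test_function_score_plus_V(1)[OF score \<phi>])
    have i: "integrable M (\<lambda>\<omega>. \<phi> (V \<omega>) * Z \<omega> $ j)" "integrable M (\<lambda>\<omega>. \<phi> (V \<omega>) * V \<omega> $ j)"
      by (intro integrable_test_function_V \<phi> integrable_Z V_moments(4))+
    have "(\<integral>\<omega>. \<phi> (V \<omega>) * h \<omega> \<partial>M) = (\<integral>\<omega>. - (1 / s) * (\<phi> (V \<omega>) * Z \<omega> $ j) + \<phi> (V \<omega>) * V \<omega> $ j \<partial>M)"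
      by (simp add: h_def algebra_simps)
    also have "\<dots> = - (1 / s) * (\<integral>\<omega>. \<phi> (V \<omega>) * Z \<omega> $ j \<partial>M) + (\<integral>\<omega>. \<phi> (V \<omega>) * V \<omega> $ j \<partial>M)"
      by (subst Bochner_Integration.integral_add) (use i in auto)
    also have "- (1 / s) * (\<integral>\<omega>. \<phi> (V \<omega>) * Z \<omega> $ j \<partial>M) = - (\<integral>\<omega>. partial_deriv j \<phi> (V \<omega>) \<partial>M)"
      unfolding gaussian_integration_by_parts[OF \<phi>, symmetric] using s_pos by simp
    finally show "(\<integral>\<omega>. \<phi> (V \<omega>) * (\<rho> (V \<omega>) $ j + V \<omega> $ j) \<partial>M) = (\<integral>\<omega>. \<phi> (V \<omega>) * h \<omega> \<partial>M)"
      using is_scoreD[OF score \<phi>, of j] i by (simp add: distrib_left)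
  qed (auto simp: h_def)
qed

lemma J_st_score:
  assumes score: "is_score M V \<rho>"
  shows "integrable M (fisher_integrand M V \<rho>)"
    and "J_st M V \<rho> = (\<Sum>j\<in>UNIV. \<integral>\<omega>. (\<rho> (V \<omega>) $ j + V \<omega> $ j)\<^sup>2 \<partial>M)"
  using J_st_V[OF _ score_plus_V_square_integrable[OF score]] score by (auto simp: is_score_def)

text \<open>With \<open>a = 0\<close> the vector \<open>V\<close> is purely Gaussian and the test
  integrals of \<open>\<rho>(V) + V\<close> vanish, so the comparison function may be 0. The value 0
  is what the bound demands, since \<open>0 * \<infinity> = 0\<close> in the extended reals.\<close>

lemma J_st_le_0_at_0:
  assumes score: "is_score M V \<rho>" and "t = 0"
  shows "J_st M V \<rho> \<le> 0"
proof -
  have [measurable]: "\<rho> \<in> borel_measurable borel" using score by (simp add: is_score_def)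
  have "a = 0" unfolding a_def using \<open>t = 0\<close> by simp
  have zero: "(\<integral>\<omega>. \<phi> (V \<omega>) * (\<rho> (V \<omega>) $ j + V \<omega> $ j) \<partial>M) = 0" if "test_function \<phi>" for \<phi> j
    unfolding integral_test_function_score_plus_V(2)[OF score that] using \<open>a = 0\<close> \<open>t = 0\<close> by simp
  have "(\<integral>\<omega>. (\<rho> (V \<omega>) $ j + V \<omega> $ j)\<^sup>2 \<partial>M) \<le> (\<integral>\<omega>. (0::real)\<^sup>2 \<partial>M)" for j
    by (rule square_integral_le_of_test_identity(2)[OF measurable_V, where g="\<lambda>x. \<rho> x $ j + x $ j"])
      (simp_all add: zero integral_test_function_score_plus_V(1)[OF score])
  then show ?thesis unfolding J_st_score(2)[OF score] by (intro sum_nonpos) simp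
qed

definition "A i \<omega> j k = (mat 1 - \<tau> i (X i \<omega>)) $ j $ k"

lemma measurable_tau [measurable]: "i \<in> {1..n} \<Longrightarrow> \<tau> i \<in> borel_measurable borel"
  using stein_X by (simp add: is_stein_matrix_def)

lemma measurable_A [measurable]: "i \<in> {1..n} \<Longrightarrow> (\<lambda>\<omega>. A i \<omega> j k) \<in> borel_measurable M"
  unfolding A_def by simp

section \<open>The bound for square integrable \<open>Id - \<tau>(X)\<close>\<close>

context
  assumes sq_A: "\<And>i j k. i \<in> {1..n} \<Longrightarrow> integrable M (\<lambda>\<omega>. (A i \<omega> j k)\<^sup>2)"
begin

lemma integrable_A: "i \<in> {1..n} \<Longrightarrow> integrable M (\<lambda>\<omega>. A i \<omega> j k)"
  by (rule square_integrable_imp_integrable[rotated]) (simp_all add: sq_A)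

lemma integrable_tau: "i \<in> {1..n} \<Longrightarrow> integrable M (\<lambda>\<omega>. \<tau> i (X i \<omega>) $ j $ k)"
proof -
  assume "i \<in> {1..n}"
  then have "integrable M (\<lambda>\<omega>. mat 1 $ j $ k - A i \<omega> j k)" by (simp add: integrable_A)
  then show ?thesis by (simp add: A_def)
qed

text \<open>Truncated coordinates in the Stein identity identify the mean of
  \<open>\<tau> i (X i)\<close> with the second moments of \<open>X i\<close>, that is, with the
  identity.\<close>

lemma mean_A:
  assumes i: "i \<in> {1..n}"
  shows "(\<integral>\<omega>. A i \<omega> j k \<partial>M) = 0"
proof -
  have "(\<integral>\<omega>. \<tau> i (X i \<omega>) $ j $ k \<partial>M) = (\<integral>\<omega>. X i \<omega> $ j * X i \<omega> $ k \<partial>M)"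
    by (rule stein_matrix_second_moment(2)[symmetric]) (use i stein_X integrable_tau in auto)
  also have "\<dots> = mat 1 $ j $ k" using Y_moments(2)[of i j k] i by (auto simp: Y_def mat_def)
  finally show ?thesis using integrable_tau[OF i] by (simp add: A_def prob_space)
qed

definition "B \<omega> j k = (\<Sum>i=1..n. A i \<omega> j k)"

text \<open>Cross terms vanish because the matrices are independent and centred. Hence the sum over
  \<open>i\<close> enters only once, which leaves the factor \<open>1 / n^2\<close> outside a single
  sum in the final bound.\<close>

lemma sq_B:
  "integrable M (\<lambda>\<omega>. (B \<omega> j k)\<^sup>2)" "(\<integral>\<omega>. (B \<omega> j k)\<^sup>2 \<partial>M) = (\<Sum>i=1..n. \<integral>\<omega>. (A i \<omega> j k)\<^sup>2 \<partial>M)"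
proof -
  have int: "integrable M (\<lambda>\<omega>. A i \<omega> j k * A i' \<omega> j k)" if "i \<in> {1..n}" "i' \<in> {1..n}" for i i'
    using that by (intro integrable_mult_of_squares sq_A) auto
  have orth: "(\<integral>\<omega>. A i \<omega> j k * A i' \<omega> j k \<partial>M) = 0" if ii: "i \<in> {1..n}" "i' \<in> {1..n}" "i \<noteq> i'" for i i'
  proof -
    have "(\<lambda>x. (mat 1 - \<tau> i x) $ j $ k) \<in> borel_measurable borel" "(\<lambda>x. (mat 1 - \<tau> i' x) $ j $ k) \<in> borel_measurable borel"
      using ii by measurable
    from indep_pair_mult(2)[OF indep_vars_pair[OF indep_X ii] this] show ?thesis
      using integrable_A mean_A ii by (simp add: A_def)
  qed
  show "integrable M (\<lambda>\<omega>. (B \<omega> j k)\<^sup>2)"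
    unfolding B_def power2_eq_square by (rule integral_sum_mult_sum(1)) (auto intro: int orth)
  show "(\<integral>\<omega>. (B \<omega> j k)\<^sup>2 \<partial>M) = (\<Sum>i=1..n. \<integral>\<omega>. (A i \<omega> j k)\<^sup>2 \<partial>M)"
    unfolding B_def power2_eq_square by (rule integral_sum_mult_sum(2)) (auto intro: int orth)
qed

text \<open>Every product separates into \<open>Z $ k * Z $ l\<close> and a function of the
  \<open>X i\<close>, which are independent; the identity covariance of \<open>Z\<close> keeps only
  the terms with \<open>k = l\<close>.\<close>

lemma sq_B_Z:
  "integrable M (\<lambda>\<omega>. (\<Sum>k\<in>UNIV. B \<omega> j k * Z \<omega> $ k)\<^sup>2)"
  "(\<integral>\<omega>. (\<Sum>k\<in>UNIV. B \<omega> j k * Z \<omega> $ k)\<^sup>2 \<partial>M) = (\<Sum>k\<in>UNIV. \<Sum>i=1..n. \<integral>\<omega>. (A i \<omega> j k)\<^sup>2 \<partial>M)"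
proof -
  have prod: "integrable M (\<lambda>\<omega>. (B \<omega> j k * Z \<omega> $ k) * (B \<omega> j l * Z \<omega> $ l)) \<and>
    (\<integral>\<omega>. (B \<omega> j k * Z \<omega> $ k) * (B \<omega> j l * Z \<omega> $ l) \<partial>M) = (if k = l then \<integral>\<omega>. (B \<omega> j k)\<^sup>2 \<partial>M else 0)" for k l
  proof -
    let ?X = "\<lambda>\<omega>. \<lambda>i\<in>{1..n}. X i \<omega>"
    define b where "b k x = (\<Sum>i=1..n. (mat 1 - \<tau> i (x i)) $ j $ k)" for k and x :: "nat \<Rightarrow> real^'d"
    have [measurable]: "b k \<in> borel_measurable (PiM {1..n} (\<lambda>_. borel))" for k
      unfolding b_def[abs_def] by measurable
    have b: "b k (?X \<omega>) = B \<omega> j k" for k \<omega>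
      by (simp add: b_def B_def A_def)
    have [measurable]: "(\<lambda>\<omega>. B \<omega> j k) \<in> borel_measurable M" for k
      unfolding B_def by measurable
    have "integrable M (\<lambda>\<omega>. B \<omega> j k * B \<omega> j l)"
      by (intro integrable_mult_of_squares sq_B) auto
    then have iB: "integrable M (\<lambda>\<omega>. b k (?X \<omega>) * b l (?X \<omega>))" by (simp only: b)
    have m: "(\<lambda>z::real^'d. z $ k * z $ l) \<in> borel_measurable borel" "(\<lambda>x. b k x * b l x) \<in> borel_measurable (PiM {1..n} (\<lambda>_. borel))"
      by measurable
    note p = indep_pair_mult[OF indep_Z m, OF Z_second_moments(1) iB]
    have eq: "(B \<omega> j k * Z \<omega> $ k) * (B \<omega> j l * Z \<omega> $ l) = (Z \<omega> $ k * Z \<omega> $ l) * (B \<omega> j k * B \<omega> j l)" for \<omega>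
      by simp
    show ?thesis
      unfolding eq using p unfolding b Z_second_moments(2) by (simp add: power2_eq_square)
  qed
  show "integrable M (\<lambda>\<omega>. (\<Sum>k\<in>UNIV. B \<omega> j k * Z \<omega> $ k)\<^sup>2)"
    unfolding power2_eq_square by (rule integral_sum_mult_sum(1)) (simp_all add: prod)
  have "(\<integral>\<omega>. (\<Sum>k\<in>UNIV. B \<omega> j k * Z \<omega> $ k)\<^sup>2 \<partial>M) = (\<Sum>k\<in>UNIV. \<integral>\<omega>. (B \<omega> j k * Z \<omega> $ k) * (B \<omega> j k * Z \<omega> $ k) \<partial>M)"
    unfolding power2_eq_square by (rule integral_sum_mult_sum(2)) (simp_all add: prod)
  also have "\<dots> = (\<Sum>k\<in>UNIV. \<Sum>i=1..n. \<integral>\<omega>. (A i \<omega> j k)\<^sup>2 \<partial>M)"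
    by (simp only: prod simp_thms if_True sq_B(2))
  finally show "(\<integral>\<omega>. (\<Sum>k\<in>UNIV. B \<omega> j k * Z \<omega> $ k)\<^sup>2 \<partial>M) = (\<Sum>k\<in>UNIV. \<Sum>i=1..n. \<integral>\<omega>. (A i \<omega> j k)\<^sup>2 \<partial>M)" .
qed

text \<open>Integrating by parts in \<open>Z\<close> trades \<open>Z $ k\<close> for
  \<open>s\<close> times the \<open>k\<close>-th partial derivative. In the resulting sum the
  identity leaves the \<open>j\<close>-th derivative, and the Stein identity in \<open>X i\<close>
  converts the \<open>\<tau>\<close> part into \<open>\<phi>(V) X i $ j / a\<close>.\<close>

lemma integral_test_function_A_Z:
  assumes \<phi>: "test_function \<phi>" and i: "i \<in> {1..n}"
  shows "integrable M (\<lambda>\<omega>. A i \<omega> j k * (\<phi> (V \<omega>) * Z \<omega> $ k))"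
    and "t > 0 \<Longrightarrow> (\<Sum>k\<in>UNIV. \<integral>\<omega>. A i \<omega> j k * (\<phi> (V \<omega>) * Z \<omega> $ k) \<partial>M)
      = s * ((\<integral>\<omega>. partial_deriv j \<phi> (V \<omega>) \<partial>M) - (\<integral>\<omega>. \<phi> (V \<omega>) * X i \<omega> $ j \<partial>M) / a)"
proof -
  let ?X = "\<lambda>\<omega>. \<lambda>i\<in>{1..n}. X i \<omega>"
  define w where "w k x = (mat 1 - \<tau> i (x i)) $ j $ k" for k and x :: "nat \<Rightarrow> real^'d"
  have w[measurable]: "w k \<in> borel_measurable (PiM {1..n} (\<lambda>_. borel))" for k
    unfolding w_def[abs_def] using i by measurable
  have wX: "w k (?X \<omega>) = A i \<omega> j k" for k \<omega>
    using i by (simp add: w_def A_def)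
  have iw: "integrable M (\<lambda>\<omega>. w k (?X \<omega>))" for k
    unfolding wX by (rule integrable_A[OF i])
  have "integrable M (\<lambda>\<omega>. Z \<omega> $ k * w k (?X \<omega>))" for k
  proof (rule indep_pair_mult(1)[OF indep_Z, where f="\<lambda>z. z $ k" and g="w k"])
    show "(\<lambda>z::real^'d. z $ k) \<in> borel_measurable borel" by measurable
  qed (rule w integrable_Z iw)+
  from integrable_test_function_V[OF \<phi> this]
  show "integrable M (\<lambda>\<omega>. A i \<omega> j k * (\<phi> (V \<omega>) * Z \<omega> $ k))"
    by (simp only: wX mult_ac)
  assume "t > 0"
  then have a: "a > 0" using n by (simp add: a_def)
  have d: "integrable M (\<lambda>\<omega>. partial_deriv k \<phi> (V \<omega>))" for k
    using integrable_test_function_V[OF test_function_partial_deriv[OF \<phi>], of "\<lambda>_. 1"] by simp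
  have d\<tau>: "integrable M (\<lambda>\<omega>. \<tau> i (X i \<omega>) $ j $ k * partial_deriv k \<phi> (V \<omega>))" for k
    using integrable_test_function_V[OF test_function_partial_deriv[OF \<phi>] integrable_tau[OF i]] by (simp add: mult.commute)
  have dA: "integrable M (\<lambda>\<omega>. A i \<omega> j k * partial_deriv k \<phi> (V \<omega>))" for k
    using integrable_test_function_V[OF test_function_partial_deriv[OF \<phi>] integrable_A[OF i]] by (simp add: mult.commute)
  \<comment> \<open>This time \<open>X i\<close> is active and everything else is frozen: the other
    summands together with the Gaussian one of index 0.\<close>
  have stein: "a * (\<integral>\<omega>. (\<Sum>k\<in>UNIV. \<tau> i (X i \<omega>) $ j $ k * partial_deriv k \<phi> (V \<omega>)) \<partial>M) = (\<integral>\<omega>. \<phi> (V \<omega>) * X i \<omega> $ j \<partial>M)"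
  proof -
    have "i \<in> {0..n}" "i \<noteq> 0" using i by auto
    then have ind: "indep_pair M borel (X i) borel (\<lambda>\<omega>. \<Sum>l\<in>{0..n}-{i}. c l *\<^sub>R Y l \<omega>)"
      using indep_vars_pair_weighted_sum[OF indep_Y, of i c] by (simp add: Y_def)
    have "a * (\<integral>\<omega>. 1 * (\<Sum>k\<in>UNIV. \<tau> i (X i \<omega>) $ j $ k * partial_deriv k \<phi> (a *\<^sub>R X i \<omega> + (\<Sum>l\<in>{0..n}-{i}. c l *\<^sub>R Y l \<omega>))) \<partial>M)
      = (\<integral>\<omega>. 1 * (\<phi> (a *\<^sub>R X i \<omega> + (\<Sum>l\<in>{0..n}-{i}. c l *\<^sub>R Y l \<omega>)) * X i \<omega> $ j) \<partial>M)"
      by (rule stein_identity_independent[OF stein_X[OF i] ind \<phi>, where u="\<lambda>x. x"])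
        (use a integrable_tau[OF i] integrable_X[OF i] in auto)
    then show ?thesis by (simp add: V_eq_X[OF i])
  qed
  have "(\<Sum>k\<in>UNIV. \<integral>\<omega>. A i \<omega> j k * (\<phi> (V \<omega>) * Z \<omega> $ k) \<partial>M)
      = (\<Sum>k\<in>UNIV. s * (\<integral>\<omega>. A i \<omega> j k * partial_deriv k \<phi> (V \<omega>) \<partial>M))"
    using gaussian_weighted_integration_by_parts[OF \<phi> w iw] by (simp only: wX)
  also have "\<dots> = s * (\<integral>\<omega>. (\<Sum>k\<in>UNIV. A i \<omega> j k * partial_deriv k \<phi> (V \<omega>)) \<partial>M)"
    using dA by (simp add: sum_distrib_left Bochner_Integration.integral_sum)
  also have "(\<lambda>\<omega>. \<Sum>k\<in>UNIV. A i \<omega> j k * partial_deriv k \<phi> (V \<omega>))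
      = (\<lambda>\<omega>. partial_deriv j \<phi> (V \<omega>) - (\<Sum>k\<in>UNIV. \<tau> i (X i \<omega>) $ j $ k * partial_deriv k \<phi> (V \<omega>)))"
    by (simp add: A_def left_diff_distrib sum_subtractf mat_def if_distrib[of "\<lambda>x. x * _"] cong: if_cong)
  also have "(\<integral>\<omega>. partial_deriv j \<phi> (V \<omega>) - (\<Sum>k\<in>UNIV. \<tau> i (X i \<omega>) $ j $ k * partial_deriv k \<phi> (V \<omega>)) \<partial>M)
      = (\<integral>\<omega>. partial_deriv j \<phi> (V \<omega>) \<partial>M) - (\<integral>\<omega>. \<phi> (V \<omega>) * X i \<omega> $ j \<partial>M) / a"
    using d d\<tau> a by (subst Bochner_Integration.integral_diff) (auto simp flip: stein)
  finally show "(\<Sum>k\<in>UNIV. \<integral>\<omega>. A i \<omega> j k * (\<phi> (V \<omega>) * Z \<omega> $ k) \<partial>M)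
      = s * ((\<integral>\<omega>. partial_deriv j \<phi> (V \<omega>) \<partial>M) - (\<integral>\<omega>. \<phi> (V \<omega>) * X i \<omega> $ j \<partial>M) / a)" .
qed

lemma J_st_le:
  assumes score: "is_score M V \<rho>" and "t > 0"
  shows "J_st M V \<rho> \<le> t\<^sup>2 / ((real n)\<^sup>2 * (1 - t)) * (\<Sum>i=1..n. \<Sum>j\<in>UNIV. \<Sum>k\<in>UNIV. \<integral>\<omega>. (A i \<omega> j k)\<^sup>2 \<partial>M)"
proof -
  have [measurable]: "\<rho> \<in> borel_measurable borel" using score by (simp add: is_score_def)
  have a: "a > 0" using \<open>t > 0\<close> n by (simp add: a_def)
  \<comment> \<open>Chosen so that \<open>C s n = - t\<close> reproduces the gradient term of
    \<open>\<rho>(V) + V\<close>; the coefficient of the \<open>X i\<close> terms then comes out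
    right because \<open>t / (n a) = a\<close>.\<close>
  define C where "C = - t / (real n * s)"
  have C2: "C\<^sup>2 = t\<^sup>2 / ((real n)\<^sup>2 * (1 - t))"
    by (simp add: C_def power_divide power_mult_distrib s_sq)
  have "(\<integral>\<omega>. (\<rho> (V \<omega>) $ j + V \<omega> $ j)\<^sup>2 \<partial>M) \<le> C\<^sup>2 * (\<Sum>k\<in>UNIV. \<Sum>i=1..n. \<integral>\<omega>. (A i \<omega> j k)\<^sup>2 \<partial>M)" for j
  proof -
    define h where "h \<omega> = C * (\<Sum>k\<in>UNIV. B \<omega> j k * Z \<omega> $ k)" for \<omega>
    have m: "h \<in> borel_measurable M" unfolding h_def B_def by measurable
    have h2: "integrable M (\<lambda>\<omega>. (h \<omega>)\<^sup>2)" "(\<integral>\<omega>. (h \<omega>)\<^sup>2 \<partial>M) = C\<^sup>2 * (\<Sum>k\<in>UNIV. \<Sum>i=1..n. \<integral>\<omega>. (A i \<omega> j k)\<^sup>2 \<partial>M)"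
      unfolding h_def power_mult_distrib using sq_B_Z[of j] by simp_all
    have "(\<integral>\<omega>. (\<rho> (V \<omega>) $ j + V \<omega> $ j)\<^sup>2 \<partial>M) \<le> (\<integral>\<omega>. (h \<omega>)\<^sup>2 \<partial>M)"
    proof (rule square_integral_le_of_test_identity(2)[OF measurable_V _ m h2(1), where g="\<lambda>x. \<rho> x $ j + x $ j"])
      fix \<phi> :: "real^'d \<Rightarrow> real" assume \<phi>: "test_function \<phi>"
      let ?D = "\<integral>\<omega>. partial_deriv j \<phi> (V \<omega>) \<partial>M" and ?X = "\<lambda>i. \<integral>\<omega>. \<phi> (V \<omega>) * X i \<omega> $ j \<partial>M"
      note AZ = integral_test_function_A_Z[OF \<phi>]
      have "(\<integral>\<omega>. \<phi> (V \<omega>) * h \<omega> \<partial>M) = (\<integral>\<omega>. C * (\<Sum>i=1..n. \<Sum>k\<in>UNIV. A i \<omega> j k * (\<phi> (V \<omega>) * Z \<omega> $ k)) \<partial>M)"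
        by (subst sum.swap) (simp add: h_def B_def sum_distrib_left sum_distrib_right mult_ac)
      also have "\<dots> = C * (\<Sum>i=1..n. \<Sum>k\<in>UNIV. \<integral>\<omega>. A i \<omega> j k * (\<phi> (V \<omega>) * Z \<omega> $ k) \<partial>M)"
        using AZ(1) by (simp add: Bochner_Integration.integral_sum)
      also have "\<dots> = C * (\<Sum>i=1..n. s * (?D - ?X i / a))"
        using AZ(2)[OF _ \<open>t > 0\<close>] by simp
      also have "\<dots> = C * s * (real n * ?D - (\<Sum>i=1..n. ?X i) / a)"
        by (simp add: sum_subtractf sum_divide_distrib flip: sum_distrib_left)
      also have "\<dots> = t / (real n * a) * (\<Sum>i=1..n. ?X i) - t * ?D"
        using s_pos n a by (simp add: C_def field_simps)
      \<comment> \<open>A restatement of \<open>a^2 = t / n\<close>, valid since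
        \<open>a > 0\<close>.\<close>
      also have "t / (real n * a) = a"
        using a_sq a n by (simp add: field_simps power2_eq_square)
      finally show "(\<integral>\<omega>. \<phi> (V \<omega>) * (\<rho> (V \<omega>) $ j + V \<omega> $ j) \<partial>M) = (\<integral>\<omega>. \<phi> (V \<omega>) * h \<omega> \<partial>M)"
        using integral_test_function_score_plus_V(2)[OF score \<phi>, of j] by simp
      show "integrable M (\<lambda>\<omega>. \<phi> (V \<omega>) * (\<rho> (V \<omega>) $ j + V \<omega> $ j))"
        by (rule integral_test_function_score_plus_V(1)[OF score \<phi>])
    qed measurable
    then show ?thesis by (simp only: h2(2))
  qed
  then have "J_st M V \<rho> \<le> (\<Sum>j\<in>UNIV. C\<^sup>2 * (\<Sum>k\<in>UNIV. \<Sum>i=1..n. \<integral>\<omega>. (A i \<omega> j k)\<^sup>2 \<partial>M))"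
    unfolding J_st_score(2)[OF score] by (rule sum_mono)
  also have "\<dots> = C\<^sup>2 * (\<Sum>i=1..n. \<Sum>j\<in>UNIV. \<Sum>k\<in>UNIV. \<integral>\<omega>. (A i \<omega> j k)\<^sup>2 \<partial>M)"
  proof -
    let ?E = "\<lambda>i j k. \<integral>\<omega>. (A i \<omega> j k)\<^sup>2 \<partial>M"
    have "(\<Sum>j\<in>UNIV. \<Sum>k\<in>UNIV. \<Sum>i=1..n. ?E i j k) = (\<Sum>j\<in>UNIV. \<Sum>i=1..n. \<Sum>k\<in>UNIV. ?E i j k)"
      by (rule sum.cong[OF refl]) (rule sum.swap)
    also have "\<dots> = (\<Sum>i=1..n. \<Sum>j\<in>UNIV. \<Sum>k\<in>UNIV. ?E i j k)" by (rule sum.swap)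
    finally show ?thesis by (simp only: sum_distrib_left[symmetric])
  qed
  finally show ?thesis by (simp only: C2)
qed

end

section \<open>The bound with extended real values\<close>

text \<open>If some trace is infinite and \<open>t > 0\<close>, a positive coefficient times
  infinity makes the bound trivial. If all traces are finite, every entry of the matrices is square
  integrable and \<open>J_st_le\<close> applies. At \<open>t = 0\<close> the right-hand side is 0
  even if a trace is infinite.\<close>

lemma J_st_bound:
  assumes score: "is_score M V \<rho>"
  shows "ereal (J_st M V \<rho>) \<le> ereal (t\<^sup>2 / ((real n)\<^sup>2 * (1 - t))) *
    (\<Sum>i=1..n. enn2ereal (trace_expectation_sq M (\<lambda>\<omega>. mat 1 - \<tau> i (X i \<omega>))))"
proof -
  let ?T = "\<lambda>i. trace_expectation_sq M (\<lambda>\<omega>. mat 1 - \<tau> i (X i \<omega>))"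
  have T: "?T i = (\<Sum>j\<in>UNIV. \<Sum>k\<in>UNIV. \<integral>\<^sup>+\<omega>. ennreal ((A i \<omega> j k)\<^sup>2) \<partial>M)" if "i \<in> {1..n}" for i
    unfolding A_def using that by (intro trace_expectation_sq_eq) measurable
  consider "t = 0" | "t > 0" "\<exists>i\<in>{1..n}. ?T i = \<infinity>" | "t > 0" "\<forall>i\<in>{1..n}. ?T i < \<infinity>"
    using t by (force simp: less_top)
  then show ?thesis
  proof cases
    case 1
    then show ?thesis using J_st_le_0_at_0[OF score] by (simp flip: zero_ereal_def)
  next
    case 2
    then have pos: "t\<^sup>2 / ((real n)\<^sup>2 * (1 - t)) > 0" using t n by simp
    have top: "(\<Sum>i=1..n. enn2ereal (?T i)) = \<infinity>"
      using 2 by auto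
    have "ereal q * \<infinity> = \<infinity>" if "q > 0" for q
      using that by simp
    then show ?thesis unfolding top by (simp only: pos ereal_less_eq)
  next
    case 3
    have fin: "(\<integral>\<^sup>+\<omega>. ennreal ((A i \<omega> j k)\<^sup>2) \<partial>M) < \<infinity>" if i: "i \<in> {1..n}" for i j k
    proof -
      have "?T i < \<infinity>" using 3(2) i by blast
      then show ?thesis unfolding T[OF i] by simp
    qed
    have sq: "integrable M (\<lambda>\<omega>. (A i \<omega> j k)\<^sup>2)" if "i \<in> {1..n}" for i j k
      using fin[OF that] that by (intro integrableI_nonneg) auto
    have "enn2ereal (?T i) = ereal (\<Sum>j\<in>UNIV. \<Sum>k\<in>UNIV. \<integral>\<omega>. (A i \<omega> j k)\<^sup>2 \<partial>M)" if i: "i \<in> {1..n}" for i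
    proof -
      have "(\<integral>\<^sup>+\<omega>. ennreal ((A i \<omega> j k)\<^sup>2) \<partial>M) = ennreal (\<integral>\<omega>. (A i \<omega> j k)\<^sup>2 \<partial>M)" for j k
        by (rule nn_integral_eq_integral[OF sq[OF i]]) simp
      then have "?T i = ennreal (\<Sum>j\<in>UNIV. \<Sum>k\<in>UNIV. \<integral>\<omega>. (A i \<omega> j k)\<^sup>2 \<partial>M)"
        unfolding T[OF i] by (simp add: sum_nonneg flip: sum_ennreal)
      then show ?thesis by (simp add: sum_nonneg)
    qed
    then have "(\<Sum>i=1..n. enn2ereal (?T i)) = ereal (\<Sum>i=1..n. \<Sum>j\<in>UNIV. \<Sum>k\<in>UNIV. \<integral>\<omega>. (A i \<omega> j k)\<^sup>2 \<partial>M)"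
      by (simp flip: sum_ereal)
    then show ?thesis using J_st_le[OF sq score 3(1)] by simp
  qed
qed

end

text \<open>Existence of a score and integrability of the Fisher integrand belong to the conclusion,
  since otherwise \<open>J_st\<close> could be a default value or the bound hold vacuously. The
  bound is extended real because the traces may be infinite.\<close>

theorem theoremV1:
  fixes M :: "'a measure"
    and n :: nat
    and X :: "nat \<Rightarrow> 'a \<Rightarrow> real^'d"
    and Z :: "'a \<Rightarrow> real^'d"
    and \<tau> :: "nat \<Rightarrow> real^'d \<Rightarrow> real^'d^'d"
    and t :: real
  assumes "prob_space M"
    and "n \<ge> 1"
    and "prob_space.indep_vars M (\<lambda>_. borel) X {1..n}"
    and "\<And>i. i \<in> {1..n} \<Longrightarrow> \<exists>f. distributed M lborel (X i) f"
    and "\<And>i. i \<in> {1..n} \<Longrightarrow> integrable M (\<lambda>\<omega>. (norm (X i \<omega>))\<^sup>2)"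
    and "\<And>i. i \<in> {1..n} \<Longrightarrow> (LINT \<omega>|M. X i \<omega>) = 0"
    and "\<And>i. i \<in> {1..n} \<Longrightarrow> covariance_matrix M (X i) = mat 1"
    and "\<And>i. i \<in> {1..n} \<Longrightarrow> is_stein_matrix M (X i) (\<tau> i)"
    and "\<And>i. i \<in> {1..n} \<Longrightarrow> \<exists>\<rho>. is_score M (X i) \<rho>"
    and "distributed M lborel Z (\<lambda>x. ennreal (std_gaussian_density x))"
    and "indep_pair M borel Z
           (PiM {1..n} (\<lambda>_. borel)) (\<lambda>\<omega>. \<lambda>i\<in>{1..n}. X i \<omega>)"
    and "0 \<le> t" and "t < 1"
  shows "(\<exists>\<rho>. is_score M (gaussian_interpolation t (normalized_sum n X) Z) \<rho>) \<and>
    (\<forall>\<rho>. is_score M (gaussian_interpolation t (normalized_sum n X) Z) \<rho> \<longrightarrow>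
       integrable M (fisher_integrand M (gaussian_interpolation t (normalized_sum n X) Z) \<rho>) \<and>
       ereal (J_st M (gaussian_interpolation t (normalized_sum n X) Z) \<rho>) \<le>
         ereal (t\<^sup>2 / ((real n)\<^sup>2 * (1 - t))) *
         (\<Sum>i=1..n. enn2ereal (trace_expectation_sq M (\<lambda>\<omega>. mat 1 - \<tau> i (X i \<omega>)))))"
proof -
  interpret prob_space M by fact
  interpret gaussian_smoothed_sum M n X Z \<tau> t
    using assms by unfold_locales auto
  show ?thesis
    using score_exists J_st_score(1) J_st_bound unfolding V_def by blast
qed

end
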